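(* (1) Every perfect tract that is not near-idempotent is excellent. (2) Every degenerate tract is excellent. (3) The Krasner hyperfield $\mathbb K$ and the tropical hyperfield $\mathbb T_0$ are excellent.
   Context: Tract: commutative monoid $F$ with absorbing $0$, $F^\times=F\setminus\{0\}$ a group, null set $N_F$ an ideal of $\mathbb N[F^\times]$ (contains $0$, closed under sums and multiplication by $\mathbb N[F^\times]$) such that each $a$ has a unique $-a$ with $a+(-a)\in N_F$. Near-idempotent: $1+1\in N_F$ and $1+1+x\in N_F$ for some $x\in F^\times$. Degenerate: every formal sum with at least three nonzero terms lies in $N_F$. $\mathbb K=\{0,1\}$ with a formal sum null iff the number of nonzero terms is not exactly one; $\mathbb T_0=\mathbb R_{\ge0}$ with usual multiplication and a formal sum null iff all terms are $0$ or the maximum is attained at least twice. For M-convex $J\subseteq\Delta^r_n$ (nonempty, exchange property), with $\delta^\mp_J$ the componentwise min/max, $\bar J=J-\delta^-_J$, $\bar r=r-|\delta^-_J|$, $\omega_J=\delta^+_J-\delta^-_J$, $\Sigma\boldsymbol\beta=\sum_m\epsilon_{\beta_m}$: a weak $F$-representation is an alternating $\rho\colon[n]^{\bar r}\to F$ with $\rho(\boldsymbol\beta)\ne0\iff\Sigma\boldsymbol\beta\in\bar J$ satisfying $\rho(\boldsymbol\alpha jk)\rho(\boldsymbol\alpha il)-\rho(\boldsymbol\alpha ik)\rho(\boldsymbol\alpha jl)+\rho(\boldsymbol\alpha ij)\rho(\boldsymbol\alpha kl)\in N_F$ whenever $\boldsymbol\alpha\in[n]^{\bar r-2}$, $\Sigma(\boldsymbol\alpha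 ijkl)\le\omega_J$; it is strong if moreover $\sum_{k=0}^s(-1)^k\rho(\boldsymbol\alpha i_0\dots\widehat{i_k}\dots i_s)\rho(\boldsymbol\alpha i_kj_2\dots j_s)\in N_F$ for all $2\le s\le\bar r$, $\boldsymbol\alpha\in[n]^{\bar r-s}$ and indices with $\Sigma(\boldsymbol\alpha i_0\dots i_sj_2\dots j_s)\le\omega_J$. $F$ is excellent if every weak $F$-representation of every M-convex set is strong. Perfect tracts: for a matroid $M$ of rank $r$ on $[n]$ (viewed as an M-convex subset of $\{0,1\}^n$) and a strong $F$-representation $\varphi\colon[n]^r\to F$, define for $x\in[n]^{r-1}$ the function $D_x(e)=\varphi(x_1,\dots,x_{r-1},e)$ and for $y\in[n]^{r+1}$ with distinct entries the function $C_y$ with $C_y(y_k)=(-1)^k\varphi(y_1,\dots,\widehat{y_k},\dots,y_{r+1})$ and $C_y(e)=0$ for $e\notin\{y_1,\dots,y_{r+1}\}$. A vector of $\varphi$ is $X\in F^n$ with $\sum_eX(e)D_x(e)\in N_F$ for all $x$; a covector is $Y\in F^n$ with $\sum_eY(e)C_y(e)\in N_F$ for all $y$. $F$ is perfect if for every matroid and every strong $F$-representation of it, $\sum_eX(e)Y(e)\in N_F$ for all vectors $X$ and covectors $Y$. *)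

theory Defs
  imports Complex_Main "HOL-Library.Multiset"
begin

text \<open>A tract on a carrier set.  Formal sums in N[F^x] are multisets of nonzero
elements; the null set is a set of such multisets.\<close>

record 'a tract =
  tcar  :: "'a set"
  tzero :: 'a
  tone  :: 'a
  tmul  :: "'a \<Rightarrow> 'a \<Rightarrow> 'a"
  tnull :: "'a multiset set"

definition fs :: "('a, 'b) tract_scheme \<Rightarrow> 'a list \<Rightarrow> 'a multiset" where
  "fs F xs = mset (filter (\<lambda>x. x \<noteq> tzero F) xs)"

definition mprod :: "('a, 'b) tract_scheme \<Rightarrow> 'a multiset \<Rightarrow> 'a multiset \<Rightarrow> 'a multiset" where
  "mprod F T S = sum_mset (image_mset (\<lambda>t. image_mset (tmul F t) S) T)"

definition is_tract :: "('a, 'b) tract_scheme \<Rightarrow> bool" where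
  "is_tract F \<longleftrightarrow>
     tzero F \<in> tcar F \<and> tone F \<in> tcar F \<and> tone F \<noteq> tzero F \<and>
     (\<forall>a\<in>tcar F. \<forall>b\<in>tcar F. tmul F a b \<in> tcar F) \<and>
     (\<forall>a\<in>tcar F. \<forall>b\<in>tcar F. \<forall>c\<in>tcar F. tmul F (tmul F a b) c = tmul F a (tmul F b c)) \<and>
     (\<forall>a\<in>tcar F. \<forall>b\<in>tcar F. tmul F a b = tmul F b a) \<and>
     (\<forall>a\<in>tcar F. tmul F (tone F) a = a) \<and>
     (\<forall>a\<in>tcar F. tmul F (tzero F) a = tzero F) \<and>
     (\<forall>a\<in>tcar F - {tzero F}. \<forall>b\<in>tcar F - {tzero F}. tmul F a b \<noteq> tzero F) \<and>
     (\<forall>a\<in>tcar F - {tzero F}. \<exists>b\<in>tcar F - {tzero F}. tmul F a b = tone F) \<and>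
     (\<forall>S\<in>tnull F. set_mset S \<subseteq> tcar F - {tzero F}) \<and>
     {#} \<in> tnull F \<and>
     (\<forall>S\<in>tnull F. \<forall>T\<in>tnull F. S + T \<in> tnull F) \<and>
     (\<forall>S\<in>tnull F. \<forall>T. set_mset T \<subseteq> tcar F - {tzero F} \<longrightarrow> mprod F T S \<in> tnull F) \<and>
     (\<forall>a\<in>tcar F. \<exists>!b. b \<in> tcar F \<and> fs F [a, b] \<in> tnull F)"

definition neg :: "('a, 'b) tract_scheme \<Rightarrow> 'a \<Rightarrow> 'a" where
  "neg F a = (THE b. b \<in> tcar F \<and> fs F [a, b] \<in> tnull F)"

definition sgnp :: "('a, 'b) tract_scheme \<Rightarrow> nat \<Rightarrow> 'a \<Rightarrow> 'a" where
  "sgnp F k a = (neg F ^^ k) a"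

definition near_idempotent :: "('a, 'b) tract_scheme \<Rightarrow> bool" where
  "near_idempotent F \<longleftrightarrow> fs F [tone F, tone F] \<in> tnull F \<and>
     (\<exists>x\<in>tcar F - {tzero F}. fs F [tone F, tone F, x] \<in> tnull F)"

definition degenerate :: "('a, 'b) tract_scheme \<Rightarrow> bool" where
  "degenerate F \<longleftrightarrow> (\<forall>S. set_mset S \<subseteq> tcar F - {tzero F} \<and> 3 \<le> size S \<longrightarrow> S \<in> tnull F)"

definition krasner :: "bool tract" where
  "krasner = \<lparr>tcar = UNIV, tzero = False, tone = True, tmul = (\<and>),
              tnull = {S. set_mset S \<subseteq> {True} \<and> size S \<noteq> 1}\<rparr>"

definition tropical :: "real tract" where
  "tropical = \<lparr>tcar = {x. 0 \<le> x}, tzero = 0, tone = 1, tmul = (*),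
              tnull = {S. set_mset S \<subseteq> {x. 0 < x} \<and> (S = {#} \<or> 2 \<le> count S (Max_mset S))}\<rparr>"

text \<open>Ground set [n] = {0..<n}; integer vectors are functions nat => nat vanishing outside [n].\<close>
definition Delta :: "nat \<Rightarrow> nat \<Rightarrow> (nat \<Rightarrow> nat) set" where
  "Delta r n = {\<alpha>. (\<forall>i\<ge>n. \<alpha> i = 0) \<and> (\<Sum>i<n. \<alpha> i) = r}"

definition m_convex :: "nat \<Rightarrow> nat \<Rightarrow> (nat \<Rightarrow> nat) set \<Rightarrow> bool" where
  "m_convex n r J \<longleftrightarrow> J \<noteq> {} \<and> J \<subseteq> Delta r n \<and>
     (\<forall>\<alpha>\<in>J. \<forall>\<beta>\<in>J. \<forall>i. \<beta> i < \<alpha> i \<longrightarrow>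
        (\<exists>j. \<alpha> j < \<beta> j \<and> \<alpha>(i := \<alpha> i - 1, j := \<alpha> j + 1) \<in> J
                         \<and> \<beta>(i := \<beta> i + 1, j := \<beta> j - 1) \<in> J))"

definition dminus :: "(nat \<Rightarrow> nat) set \<Rightarrow> nat \<Rightarrow> nat" where
  "dminus J e = Min ((\<lambda>\<alpha>. \<alpha> e) ` J)"

definition dplus :: "(nat \<Rightarrow> nat) set \<Rightarrow> nat \<Rightarrow> nat" where
  "dplus J e = Max ((\<lambda>\<alpha>. \<alpha> e) ` J)"

definition Jbar :: "(nat \<Rightarrow> nat) set \<Rightarrow> (nat \<Rightarrow> nat) set" where
  "Jbar J = (\<lambda>\<alpha> e. \<alpha> e - dminus J e) ` J"

definition rbar :: "nat \<Rightarrow> nat \<Rightarrow> (nat \<Rightarrow> nat) set \<Rightarrow> nat" where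
  "rbar n r J = r - (\<Sum>e<n. dminus J e)"

definition omega :: "(nat \<Rightarrow> nat) set \<Rightarrow> nat \<Rightarrow> nat" where
  "omega J e = dplus J e - dminus J e"

definition Sig :: "nat list \<Rightarrow> nat \<Rightarrow> nat" where
  "Sig \<beta> = (\<lambda>e. count (mset \<beta>) e)"

definition idx :: "nat \<Rightarrow> nat \<Rightarrow> nat list set" where
  "idx n k = {\<beta>. length \<beta> = k \<and> set \<beta> \<subseteq> {..<n}}"

definition rem :: "nat \<Rightarrow> 'c list \<Rightarrow> 'c list" where
  "rem k xs = take k xs @ drop (Suc k) xs"

definition alternating :: "('a, 'b) tract_scheme \<Rightarrow> nat \<Rightarrow> nat \<Rightarrow> (nat list \<Rightarrow> 'a) \<Rightarrow> bool" where
  "alternating F n k \<rho> \<longleftrightarrow>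
     (\<forall>\<beta>\<in>idx n k. \<forall>i j. i < k \<and> j < k \<and> i \<noteq> j \<longrightarrow>
        \<rho> (\<beta>[i := \<beta> ! j, j := \<beta> ! i]) = neg F (\<rho> \<beta>))"

definition weak_rep :: "('a, 'b) tract_scheme \<Rightarrow> nat \<Rightarrow> nat \<Rightarrow> (nat \<Rightarrow> nat) set \<Rightarrow> (nat list \<Rightarrow> 'a) \<Rightarrow> bool" where
  "weak_rep F n r J \<rho> \<longleftrightarrow>
     (\<forall>\<beta>\<in>idx n (rbar n r J). \<rho> \<beta> \<in> tcar F) \<and>
     alternating F n (rbar n r J) \<rho> \<and>
     (\<forall>\<beta>\<in>idx n (rbar n r J). \<rho> \<beta> \<noteq> tzero F \<longleftrightarrow> Sig \<beta> \<in> Jbar J) \<and>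
     (2 \<le> rbar n r J \<longrightarrow>
       (\<forall>\<alpha>\<in>idx n (rbar n r J - 2). \<forall>i<n. \<forall>j<n. \<forall>k<n. \<forall>l<n.
          Sig (\<alpha> @ [i, j, k, l]) \<le> omega J \<longrightarrow>
          fs F [tmul F (\<rho> (\<alpha> @ [j, k])) (\<rho> (\<alpha> @ [i, l])),
                neg F (tmul F (\<rho> (\<alpha> @ [i, k])) (\<rho> (\<alpha> @ [j, l]))),
                tmul F (\<rho> (\<alpha> @ [i, j])) (\<rho> (\<alpha> @ [k, l]))] \<in> tnull F))"

definition strong_rep :: "('a, 'b) tract_scheme \<Rightarrow> nat \<Rightarrow> nat \<Rightarrow> (nat \<Rightarrow> nat) set \<Rightarrow> (nat list \<Rightarrow> 'a) \<Rightarrow> bool" where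
  "strong_rep F n r J \<rho> \<longleftrightarrow> weak_rep F n r J \<rho> \<and>
     (\<forall>s. 2 \<le> s \<and> s \<le> rbar n r J \<longrightarrow>
       (\<forall>\<alpha>\<in>idx n (rbar n r J - s). \<forall>is\<in>idx n (s + 1). \<forall>js\<in>idx n (s - 1).
          Sig (\<alpha> @ is @ js) \<le> omega J \<longrightarrow>
          fs F (map (\<lambda>k. sgnp F k (tmul F (\<rho> (\<alpha> @ rem k is)) (\<rho> (\<alpha> @ (is ! k) # js))))
                    [0..<s + 1]) \<in> tnull F))"

definition excellent :: "('a, 'b) tract_scheme \<Rightarrow> bool" where
  "excellent F \<longleftrightarrow>
     (\<forall>n r J \<rho>. m_convex n r J \<and> weak_rep F n r J \<rho> \<longrightarrow> strong_rep F n r J \<rho>)"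

text \<open>A matroid of rank r on [n], given by the indicator vectors of its bases.\<close>
definition matroid :: "nat \<Rightarrow> nat \<Rightarrow> (nat \<Rightarrow> nat) set \<Rightarrow> bool" where
  "matroid n r J \<longleftrightarrow> m_convex n r J \<and> (\<forall>\<alpha>\<in>J. \<forall>e. \<alpha> e \<le> 1)"

definition strong_gp :: "('a, 'b) tract_scheme \<Rightarrow> nat \<Rightarrow> nat \<Rightarrow> (nat \<Rightarrow> nat) set \<Rightarrow> (nat list \<Rightarrow> 'a) \<Rightarrow> bool" where
  "strong_gp F n r J \<phi> \<longleftrightarrow>
     (\<forall>\<beta>\<in>idx n r. \<phi> \<beta> \<in> tcar F) \<and>
     alternating F n r \<phi> \<and>
     (\<forall>\<beta>\<in>idx n r. \<phi> \<beta> \<noteq> tzero F \<longleftrightarrow> Sig \<beta> \<in> J) \<and>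
     (1 \<le> r \<longrightarrow>
       (\<forall>x\<in>idx n (r + 1). \<forall>y\<in>idx n (r - 1).
          fs F (map (\<lambda>k. sgnp F k (tmul F (\<phi> (rem k x)) (\<phi> ((x ! k) # y)))) [0..<r + 1])
            \<in> tnull F))"

definition Dfun :: "(nat list \<Rightarrow> 'a) \<Rightarrow> nat list \<Rightarrow> nat \<Rightarrow> 'a" where
  "Dfun \<phi> x e = \<phi> (x @ [e])"

text \<open>C_y(y_k) = (-1)^k phi(y without y_k), k = 1..r+1 (0-based position p gives k = p+1).\<close>
definition Cfun :: "('a, 'b) tract_scheme \<Rightarrow> (nat list \<Rightarrow> 'a) \<Rightarrow> nat list \<Rightarrow> nat \<Rightarrow> 'a" where
  "Cfun F \<phi> y e = (if e \<in> set y
      then (let p = (THE p. p < length y \<and> y ! p = e) in sgnp F (Suc p) (\<phi> (rem p y)))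
      else tzero F)"

definition is_vector :: "('a, 'b) tract_scheme \<Rightarrow> nat \<Rightarrow> nat \<Rightarrow> (nat list \<Rightarrow> 'a) \<Rightarrow> (nat \<Rightarrow> 'a) \<Rightarrow> bool" where
  "is_vector F n r \<phi> X \<longleftrightarrow> (\<forall>e<n. X e \<in> tcar F) \<and>
     (1 \<le> r \<longrightarrow> (\<forall>x\<in>idx n (r - 1).
        fs F (map (\<lambda>e. tmul F (X e) (Dfun \<phi> x e)) [0..<n]) \<in> tnull F))"

definition is_covector :: "('a, 'b) tract_scheme \<Rightarrow> nat \<Rightarrow> nat \<Rightarrow> (nat list \<Rightarrow> 'a) \<Rightarrow> (nat \<Rightarrow> 'a) \<Rightarrow> bool" where
  "is_covector F n r \<phi> Y \<longleftrightarrow> (\<forall>e<n. Y e \<in> tcar F) \<and>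
     (\<forall>y\<in>idx n (r + 1). distinct y \<longrightarrow>
        fs F (map (\<lambda>e. tmul F (Y e) (Cfun F \<phi> y e)) [0..<n]) \<in> tnull F)"

definition perfect :: "('a, 'b) tract_scheme \<Rightarrow> bool" where
  "perfect F \<longleftrightarrow>
     (\<forall>n r J \<phi>. matroid n r J \<and> strong_gp F n r J \<phi> \<longrightarrow>
        (\<forall>X Y. is_vector F n r \<phi> X \<and> is_covector F n r \<phi> Y \<longrightarrow>
           fs F (map (\<lambda>e. tmul F (X e) (Y e)) [0..<n]) \<in> tnull F))"

end

(*
  Regarding the positions of a list with sum at most \<omega>\<^sub>J as distinct copies of their labels turns a weak
  representation of an M-convex set into one of a matroid, so only matroids matter.  There, strong relations with an entry common to both lists reduce to
  shorter ones, and the relation for \<alpha>, xs, ys (everything distinct) is obtained from the shorter ones: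

  If F is perfect and ys = e # ys', contract \<alpha> and e and restrict to xs.  The shorter relations make this
  a strong representation, the fundamental circuit on xs one of its vectors, and the fundamental
  cocircuit of ys one of its covectors; their orthogonality is the relation sought.

  If F is degenerate (for instance the Krasner hyperfield), only sums with two nonzero terms matter;
  exchanging an element of ys for a well-chosen one of xs produces a shorter relation and a 3-term
  relation, each with just two nonzero terms, whose product gives the cancellation.

  For the tropical hyperfield the relation is the exchange property of valuated matroids.
*)
theory Submission
  imports Defs "HOL-Combinatorics.Transposition"
begin

section \<open>Lists and formal sums\<close>

text \<open>Multiplicities obstruct working with M-convex sets directly: where 1 + 1 is null, a
  representation may be nonzero on a list with repeated labels. The positions in the index list of
  the one relation under study are distinct, and the bound by \<omega> on that list bounds every
  relation on distinct positions in it. So each relation gets a matroid of its own, possibly one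
  without bases. Perfect case: contracting e lowers the rank by one, which makes every
  Grassmann-Pluecker relation of the minor a shorter one. The vector condition involves relations of
  full length, but their right-hand lists \<open>e # z\<close> have \<open>z\<close> inside
  \<open>xs\<close>; sharing an entry with \<open>xs\<close>, they reduce as well. Only the pairing
  of vector and covector is of full length with disjoint lists. Degenerate case: the exchanged
  element w has to make the unwanted terms vanish in both auxiliary relations at once, which is why
  its choice needs a case distinction.\<close>

lemma rem_simps [simp]:
  "rem 0 (x # xs) = xs" "rem (Suc k) (x # xs) = x # rem k xs"
  by (simp_all add: rem_def)

lemma rem_append:
  "rem k (xs @ ys) = (if k < length xs then rem k xs @ ys else xs @ rem (k - length xs) ys)"
  by (auto simp: rem_def Suc_diff_le)

lemma length_rem [simp]: "k < length xs \<Longrightarrow> length (rem k xs) = length xs - 1"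
  by (simp add: rem_def)

lemma set_rem_subset: "set (rem k xs) \<subseteq> set xs"
  by (auto simp: rem_def dest: in_set_takeD in_set_dropD)

lemma set_rem: "distinct xs \<Longrightarrow> k < length xs \<Longrightarrow> set (rem k xs) = set xs - {xs ! k}"
proof -
  assume "distinct xs" "k < length xs"
  then have "xs = take k xs @ xs ! k # drop (Suc k) xs" and "distinct (take k xs @ xs ! k # drop (Suc k) xs)"
    by (simp_all add: id_take_nth_drop[symmetric])
  then have "set xs = set (take k xs) \<union> {xs ! k} \<union> set (drop (Suc k) xs)"
    by (metis Un_insert_right list.simps(15) set_append sup_bot.right_neutral sup_left_commute Un_insert_left)
  with \<open>distinct (take k xs @ xs ! k # drop (Suc k) xs)\<close> show ?thesis
    by (auto simp: rem_def)
qed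

lemma distinct_rem: "distinct xs \<Longrightarrow> distinct (rem k xs)"
  by (metis append_take_drop_id distinct_append drop_Suc rem_def distinct_drop distinct_take
      disjoint_iff in_set_dropD in_set_takeD set_take_disj_set_drop_if_distinct order_refl le_SucI)

lemma map_rem: "map f (rem k xs) = rem k (map f xs)"
  by (simp add: rem_def take_map drop_map)

text \<open>Adjacent transpositions generate all permutations; for alternating functions only a swap
  of neighbours then needs checking. \<open>front\<close> carries an entry to the left, one
  neighbour at a time.\<close>

lemma mset_swap_induct [consumes 2, case_names swap]:
  assumes "mset xs = mset ys" "Q xs"
    and swap: "\<And>ps a b qs. Q (ps @ a # b # qs) \<Longrightarrow> Q (ps @ b # a # qs)"
  shows "Q ys"
proof -
  have front: "Q (ps @ vs @ a # qs) \<Longrightarrow> Q (ps @ a # vs @ qs)" for ps vs a qs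
  proof (induction vs arbitrary: qs rule: rev_induct)
    case (snoc v vs)
    from swap[of "ps @ vs" v a qs] snoc.prems have "Q (ps @ vs @ a # v # qs)" by simp
    from snoc.IH[OF this] show ?case by simp
  qed simp
  have "mset xs = mset ys \<Longrightarrow> Q (ps @ xs) \<Longrightarrow> Q (ps @ ys)" for ps
  proof (induction ys arbitrary: xs ps)
    case (Cons y ys)
    then obtain vs ws where xs: "xs = vs @ y # ws"
      by (metis list.set_intros(1) mset_eq_setD split_list)
    with Cons.prems have "mset (vs @ ws) = mset ys" "Q ((ps @ [y]) @ (vs @ ws))"
      using front[of ps vs y ws] by simp_all
    from Cons.IH[OF this] show ?case by simp
  qed simp
  from this[of "[]"] assms show ?thesis by simp
qed

lemma fs_eq_filter_mset: "fs F xs = filter_mset (\<lambda>x. x \<noteq> tzero F) (mset xs)"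
  by (simp add: fs_def)

lemma fs_append: "fs F (xs @ ys) = fs F xs + fs F ys"
  by (simp add: fs_def)

lemma fs_all_zero: "(\<And>x. x \<in> set xs \<Longrightarrow> x = tzero F) \<Longrightarrow> fs F xs = {#}"
  by (auto simp: fs_def filter_empty_conv)

lemma fs_reindex:
  assumes "bij_betw p {..<n} {..<n}"
  shows "fs F (map (\<lambda>k. h (p k)) [0..<n]) = fs F (map h [0..<n])"
proof -
  have "image_mset p (mset_set {0..<n}) = mset_set {0..<n}"
    using assms by (metis atLeast0LessThan bij_betw_def image_mset_mset_set)
  then have "image_mset h (image_mset p (mset_set {0..<n})) = image_mset h (mset_set {0..<n})" by simp
  then show ?thesis by (simp add: fs_eq_filter_mset image_mset.compositionality o_def)
qed

lemma fs_map_support: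
  assumes "distinct xs" "set xs \<subseteq> {..<m}" and zero: "\<And>a. a < m \<Longrightarrow> a \<notin> set xs \<Longrightarrow> h a = tzero F"
  shows "fs F (map h [0..<m]) = fs F (map h xs)"
proof -
  have "mset_set {0..<m} = mset_set (set xs) + mset_set ({0..<m} - set xs)"
    using assms(2) by (subst mset_set_Union[symmetric]) (auto simp: Un_absorb1 lessThan_atLeast0)
  moreover have "filter_mset (\<lambda>x. x \<noteq> tzero F) (image_mset h (mset_set ({0..<m} - set xs))) = {#}"
    using zero by (auto simp: multiset_eq_iff count_eq_zero_iff)
  ultimately show ?thesis
    by (simp add: fs_eq_filter_mset mset_set_set[OF assms(1)])
qed

section \<open>Arithmetic in a tract\<close>

locale tract_laws =
  fixes F :: "('a, 'b) tract_scheme"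
  assumes tract: "is_tract F"
begin

abbreviation mult (infixl "\<odot>" 70) where "x \<odot> y \<equiv> tmul F x y"
abbreviation zero ("\<zero>") where "\<zero> \<equiv> tzero F"
abbreviation carr where "carr \<equiv> tcar F"
abbreviation null_sum where "null_sum xs \<equiv> fs F xs \<in> tnull F"

lemma tract_unfolded:
  "\<zero> \<in> carr" "tone F \<in> carr" "tone F \<noteq> \<zero>"
  "\<forall>a\<in>carr. \<forall>b\<in>carr. a \<odot> b \<in> carr"
  "\<forall>a\<in>carr. \<forall>b\<in>carr. \<forall>c\<in>carr. a \<odot> b \<odot> c = a \<odot> (b \<odot> c)"
  "\<forall>a\<in>carr. \<forall>b\<in>carr. a \<odot> b = b \<odot> a"
  "\<forall>a\<in>carr. tone F \<odot> a = a"
  "\<forall>a\<in>carr. \<zero> \<odot> a = \<zero>"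
  "\<forall>a\<in>carr - {\<zero>}. \<forall>b\<in>carr - {\<zero>}. a \<odot> b \<noteq> \<zero>"
  "\<forall>a\<in>carr - {\<zero>}. \<exists>b\<in>carr - {\<zero>}. a \<odot> b = tone F"
  "{#} \<in> tnull F"
  "\<forall>S\<in>tnull F. \<forall>T. set_mset T \<subseteq> carr - {\<zero>} \<longrightarrow> mprod F T S \<in> tnull F"
  "\<forall>a\<in>carr. \<exists>!b. b \<in> carr \<and> null_sum [a, b]"
  using tract unfolding is_tract_def by - (elim conjE; assumption)+

lemma zero_car [simp]: "\<zero> \<in> carr" and one_car [simp]: "tone F \<in> carr"
  and empty_null [simp]: "{#} \<in> tnull F"
  by (fact tract_unfolded)+

lemma mult_car [simp]: "a \<in> carr \<Longrightarrow> b \<in> carr \<Longrightarrow> a \<odot> b \<in> carr"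
  using tract_unfolded(4) by blast

lemma mult_assoc: "a \<in> carr \<Longrightarrow> b \<in> carr \<Longrightarrow> c \<in> carr \<Longrightarrow> a \<odot> b \<odot> c = a \<odot> (b \<odot> c)"
  using tract_unfolded(5) by blast

lemma mult_comm: "a \<in> carr \<Longrightarrow> b \<in> carr \<Longrightarrow> a \<odot> b = b \<odot> a"
  using tract_unfolded(6) by blast

lemma mult_left_comm: "a \<in> carr \<Longrightarrow> b \<in> carr \<Longrightarrow> c \<in> carr \<Longrightarrow> a \<odot> (b \<odot> c) = b \<odot> (a \<odot> c)"
  by (metis mult_assoc mult_comm)

lemma one_mult [simp]: "a \<in> carr \<Longrightarrow> tone F \<odot> a = a"
  using tract_unfolded(7) by blast

lemma zero_mult [simp]: "a \<in> carr \<Longrightarrow> \<zero> \<odot> a = \<zero>"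
  using tract_unfolded(8) by blast

lemma mult_nonzero: "a \<in> carr \<Longrightarrow> b \<in> carr \<Longrightarrow> a \<noteq> \<zero> \<Longrightarrow> b \<noteq> \<zero> \<Longrightarrow> a \<odot> b \<noteq> \<zero>"
  using tract_unfolded(9) by blast

lemma mult_zero [simp]: "a \<in> carr \<Longrightarrow> a \<odot> \<zero> = \<zero>"
  using mult_comm[of a \<zero>] by simp

lemma mult_eq_zero [simp]: "a \<in> carr \<Longrightarrow> b \<in> carr \<Longrightarrow> a \<odot> b = \<zero> \<longleftrightarrow> a = \<zero> \<or> b = \<zero>"
  using mult_nonzero by auto

lemma mult_cancel_left:
  assumes "c \<in> carr" "a \<in> carr" "b \<in> carr" "c \<noteq> \<zero>" "c \<odot> a = c \<odot> b"
  shows "a = b"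
proof -
  obtain d where d: "d \<in> carr" "c \<odot> d = tone F"
    using tract_unfolded(10) assms(1,4) by blast
  have "d \<odot> (c \<odot> a) = d \<odot> (c \<odot> b)" using assms by simp
  then have "d \<odot> c \<odot> a = d \<odot> c \<odot> b" using assms d by (simp add: mult_assoc)
  then show ?thesis using assms d mult_comm[of d c] by simp
qed

text \<open>For nonzero \<open>c\<close> this is the ideal property applied to the singleton
  \<open>{#c#}\<close>; for \<open>c\<close> zero every term is dropped and the empty sum
  remains.\<close>

lemma null_scale:
  assumes "c \<in> carr" "set xs \<subseteq> carr" "null_sum xs"
  shows "null_sum (map (tmul F c) xs)"
proof (cases "c = \<zero>")
  case True
  then show ?thesis using assms by (subst fs_all_zero) auto
next
  case False
  have "filter (\<lambda>x. x \<noteq> \<zero>) (map (tmul F c) xs) = map (tmul F c) (filter (\<lambda>x. x \<noteq> \<zero>) xs)"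
    using assms(1,2) False by (induction xs) auto
  then have "fs F (map (tmul F c) xs) = mprod F {#c#} (fs F xs)"
    by (simp add: fs_def mprod_def)
  moreover have "mprod F {#c#} (fs F xs) \<in> tnull F"
  proof -
    have "set_mset {#c#} \<subseteq> carr - {\<zero>}" using assms(1) False by simp
    then show ?thesis using tract_unfolded(12) assms(3) by blast
  qed
  ultimately show ?thesis by simp
qed

lemma ex1_neg: "a \<in> carr \<Longrightarrow> \<exists>!b. b \<in> carr \<and> null_sum [a, b]"
  using tract_unfolded(13) by blast

lemma neg_car [simp]: "a \<in> carr \<Longrightarrow> neg F a \<in> carr"
  and null_neg: "a \<in> carr \<Longrightarrow> null_sum [a, neg F a]"
  using theI'[OF ex1_neg[of a]] unfolding neg_def by auto

lemma neg_unique: "a \<in> carr \<Longrightarrow> b \<in> carr \<Longrightarrow> null_sum [a, b] \<Longrightarrow> b = neg F a"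
  using ex1_neg[of a] null_neg[of a] neg_car[of a] by blast

lemma neg_neg [simp]: "a \<in> carr \<Longrightarrow> neg F (neg F a) = a"
proof -
  assume a: "a \<in> carr"
  have "fs F [neg F a, a] = fs F [a, neg F a]" by (simp add: fs_def)
  then show ?thesis using a neg_unique[of "neg F a" a] null_neg[OF a] by simp
qed

lemma neg_zero [simp]: "neg F \<zero> = \<zero>"
  by (rule neg_unique[symmetric]) (auto simp: fs_def)

lemma neg_eq_zero [simp]: "a \<in> carr \<Longrightarrow> neg F a = \<zero> \<longleftrightarrow> a = \<zero>"
  by (metis neg_neg neg_zero)

lemma neg_inject [simp]: "a \<in> carr \<Longrightarrow> b \<in> carr \<Longrightarrow> neg F a = neg F b \<longleftrightarrow> a = b"
  by (metis neg_neg)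

lemma mult_neg_right [simp]: "a \<in> carr \<Longrightarrow> b \<in> carr \<Longrightarrow> a \<odot> neg F b = neg F (a \<odot> b)"
  using null_scale[of a "[b, neg F b]"] null_neg[of b] by (intro neg_unique) auto

lemma mult_neg_left [simp]: "a \<in> carr \<Longrightarrow> b \<in> carr \<Longrightarrow> neg F a \<odot> b = neg F (a \<odot> b)"
  by (metis mult_neg_right mult_comm neg_car)

lemma sgnp_simps [simp]: "sgnp F 0 a = a" "sgnp F (Suc k) a = neg F (sgnp F k a)"
  by (simp_all add: sgnp_def)

lemma sgnp_add: "sgnp F (j + k) a = sgnp F j (sgnp F k a)"
  by (simp add: sgnp_def funpow_add)

lemma sgnp_car [simp]: "a \<in> carr \<Longrightarrow> sgnp F k a \<in> carr"
  by (induction k) auto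

lemma sgnp_zero [simp]: "sgnp F k \<zero> = \<zero>"
  by (induction k) auto

lemma sgnp_eq_zero [simp]: "a \<in> carr \<Longrightarrow> sgnp F k a = \<zero> \<longleftrightarrow> a = \<zero>"
  by (induction k) auto

lemma neg_sgnp: "sgnp F k (neg F a) = neg F (sgnp F k a)"
  by (simp add: sgnp_def funpow_swap1)

lemma sgnp_sgnp [simp]: "a \<in> carr \<Longrightarrow> sgnp F k (sgnp F k a) = a"
  by (induction k) (auto simp: neg_sgnp)

lemma sgnp_comm: "sgnp F j (sgnp F k a) = sgnp F k (sgnp F j a)"
  by (metis sgnp_add add.commute)

lemma mult_sgnp_right [simp]: "a \<in> carr \<Longrightarrow> b \<in> carr \<Longrightarrow> a \<odot> sgnp F k b = sgnp F k (a \<odot> b)"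
  by (induction k) auto

lemma mult_sgnp_left [simp]: "a \<in> carr \<Longrightarrow> b \<in> carr \<Longrightarrow> sgnp F k a \<odot> b = sgnp F k (a \<odot> b)"
  by (induction k) auto

text \<open>A sign is multiplication by the element \<open>sgnp F j (tone F)\<close>, so a sign
  common to all terms can be moved in or out of a relation.\<close>

lemma null_sum_sgnp:
  assumes "null_sum (map h L)" "\<And>x. x \<in> set L \<Longrightarrow> h x \<in> carr" "\<And>x. x \<in> set L \<Longrightarrow> h' x = sgnp F j (h x)"
  shows "null_sum (map h' L)"
proof -
  have "h' x = sgnp F j (tone F) \<odot> h x" if "x \<in> set L" for x
    using assms that by simp
  then have "map h' L = map (tmul F (sgnp F j (tone F))) (map h L)" by simp
  then show ?thesis using assms null_scale[of "sgnp F j (tone F)" "map h L"] by (auto simp del: map_map)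
qed

end

section \<open>Grassmann-Pluecker relations of matroids\<close>

locale alternating_fun = tract_laws +
  fixes m q :: nat and \<phi> :: "nat list \<Rightarrow> 'a"
  assumes phi_car': "\<beta> \<in> idx m q \<Longrightarrow> \<phi> \<beta> \<in> tcar F"
    and phi_alt: "alternating F m q \<phi>"
begin

lemma phi_car [simp]: "set \<beta> \<subseteq> {..<m} \<Longrightarrow> length \<beta> = q \<Longrightarrow> \<phi> \<beta> \<in> carr"
  using phi_car' by (simp add: idx_def)

lemma phi_swap:
  assumes "set (ps @ a # b # qs) \<subseteq> {..<m}" "length (ps @ a # b # qs) = q"
  shows "\<phi> (ps @ b # a # qs) = neg F (\<phi> (ps @ a # b # qs))"
proof -
  let ?\<beta> = "ps @ a # b # qs"
  have "\<phi> (?\<beta>[length ps := ?\<beta> ! Suc (length ps), Suc (length ps) := ?\<beta> ! length ps]) = neg F (\<phi> ?\<beta>)"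
    using phi_alt assms unfolding alternating_def idx_def
    by (metis (mono_tags, lifting) mem_Collect_eq length_append length_Cons less_add_Suc1 add_Suc_right
        n_not_Suc_n Suc_less_eq)
  moreover have "?\<beta>[length ps := ?\<beta> ! Suc (length ps), Suc (length ps) := ?\<beta> ! length ps] = ps @ b # a # qs"
    by (simp add: nth_append list_update_append)
  ultimately show ?thesis by simp
qed

lemma phi_move:
  assumes "set (ps @ a # vs @ qs) \<subseteq> {..<m}" "length (ps @ a # vs @ qs) = q"
  shows "\<phi> (ps @ vs @ a # qs) = sgnp F (length vs) (\<phi> (ps @ a # vs @ qs))"
  using assms
proof (induction vs arbitrary: qs rule: rev_induct)
  case (snoc v vs)
  have "\<phi> ((ps @ vs) @ v # a # qs) = neg F (\<phi> ((ps @ vs) @ a # v # qs))"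
    by (rule phi_swap) (use snoc.prems in auto)
  with snoc.IH[of "v # qs"] snoc.prems show ?case by simp
qed simp

section \<open>Grassmann-Pluecker sums and permutations of their entries\<close>

definition gp_term :: "nat list \<Rightarrow> nat list \<Rightarrow> nat list \<Rightarrow> nat \<Rightarrow> 'a" where
  "gp_term \<alpha> xs ys k = sgnp F k (\<phi> (\<alpha> @ rem k xs) \<odot> \<phi> (\<alpha> @ xs ! k # ys))"

definition gp_null :: "nat list \<Rightarrow> nat list \<Rightarrow> nat list \<Rightarrow> bool" where
  "gp_null \<alpha> xs ys \<longleftrightarrow> null_sum (map (gp_term \<alpha> xs ys) [0..<length xs])"

text \<open>The parameter \<open>d\<close> is s - 1 in the strong relations: d = 1 gives the
  three-term relations, d = 0 a trivial two-term one. All inductions run over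
  \<open>d\<close>.\<close>

definition gp_shape :: "nat list \<Rightarrow> nat list \<Rightarrow> nat list \<Rightarrow> nat \<Rightarrow> bool" where
  "gp_shape \<alpha> xs ys d \<longleftrightarrow> set \<alpha> \<union> set xs \<union> set ys \<subseteq> {..<m} \<and> length xs = d + 2 \<and> length ys = d \<and> length \<alpha> + d + 1 = q"

lemma gp_factor_car [simp]:
  assumes "gp_shape \<alpha> xs ys d" "k < length xs"
  shows "\<phi> (\<alpha> @ rem k xs) \<in> carr" "\<phi> (\<alpha> @ xs ! k # ys) \<in> carr"
  using assms set_rem_subset[of k xs] nth_mem[of k xs] unfolding gp_shape_def by (auto intro!: phi_car simp: subset_iff)

lemma gp_term_car: "gp_shape \<alpha> xs ys d \<Longrightarrow> k < length xs \<Longrightarrow> gp_term \<alpha> xs ys k \<in> carr"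
  by (simp add: gp_term_def)

text \<open>The transposition \<open>?p\<close> permutes the terms, and every sign flips: for the
  entries of \<open>ps\<close> and \<open>qs\<close> because the left factor contains both swapped
  entries, for \<open>a\<close> and \<open>b\<close> themselves because their position changes
  parity.\<close>

lemma gp_null_swap_left:
  assumes shape: "gp_shape \<alpha> (ps @ a # b # qs) ys d" and null: "gp_null \<alpha> (ps @ a # b # qs) ys"
  shows "gp_null \<alpha> (ps @ b # a # qs) ys"
proof -
  let ?xs = "ps @ a # b # qs" and ?xs' = "ps @ b # a # qs"
  let ?p = "transpose (length ps) (Suc (length ps))" and ?n = "length ps + length qs + 2"
  have bij: "bij_betw ?p {..<?n} {..<?n}"
    by (rule bij_betw_byWitness[where f' = ?p]) (auto simp: transpose_def)
  have "gp_term \<alpha> ?xs' ys k = neg F (gp_term \<alpha> ?xs ys (?p k))" if k: "k < ?n" for k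
  proof -
    consider "k < length ps" | "k = length ps" | "k = Suc (length ps)"
      | "length ps + 2 \<le> k" by linarith
    then show ?thesis
    proof cases
      case 1
      have "\<phi> ((\<alpha> @ rem k ps) @ b # a # qs) = neg F (\<phi> ((\<alpha> @ rem k ps) @ a # b # qs))"
        using shape 1 set_rem_subset[of k ps] by (intro phi_swap) (auto simp: gp_shape_def)
      then show ?thesis using 1 gp_factor_car[OF shape, of k]
        by (simp add: gp_term_def rem_append nth_append transpose_def neg_sgnp)
    next
      case 2
      then show ?thesis using gp_factor_car[OF shape, of "Suc k"]
        by (simp add: gp_term_def rem_append nth_append transpose_def)
    next
      case 3
      then show ?thesis using gp_factor_car[OF shape, of "length ps"]
        by (simp add: gp_term_def rem_append nth_append transpose_def)
    next
      case 4
      define j where "j = k - (length ps + 2)"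
      with 4 k have j: "k = length ps + Suc (Suc j)" "j < length qs" by auto
      have "\<phi> ((\<alpha> @ ps) @ b # a # rem j qs) = neg F (\<phi> ((\<alpha> @ ps) @ a # b # rem j qs))"
        using shape j set_rem_subset[of j qs] by (intro phi_swap) (auto simp: gp_shape_def)
      then show ?thesis using j gp_factor_car[OF shape, of k]
        by (simp add: gp_term_def rem_append nth_append transpose_def neg_sgnp)
    qed
  qed
  moreover have "null_sum (map (\<lambda>k. gp_term \<alpha> ?xs ys (?p k)) [0..<?n])"
    using null fs_reindex[OF bij, of F] by (simp add: gp_null_def)
  moreover have "gp_term \<alpha> ?xs ys (?p k) \<in> carr" if "k < ?n" for k
    using that by (intro gp_term_car[OF shape]) (auto simp: transpose_def)
  ultimately have "null_sum (map (gp_term \<alpha> ?xs' ys) [0..<?n])"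
    by - (rule null_sum_sgnp[where j = 1 and h = "\<lambda>k. gp_term \<alpha> ?xs ys (?p k)"], simp_all del: upt_Suc)
  then show ?thesis by (simp add: gp_null_def)
qed

lemma gp_null_perm_left:
  assumes "mset xs = mset xs'" "gp_shape \<alpha> xs ys d" "gp_null \<alpha> xs ys"
  shows "gp_null \<alpha> xs' ys"
proof -
  have "gp_shape \<alpha> xs ys d \<and> gp_null \<alpha> xs ys" using assms by simp
  with assms(1) have "gp_shape \<alpha> xs' ys d \<and> gp_null \<alpha> xs' ys"
  proof (induction rule: mset_swap_induct)
    case (swap ps a b qs)
    then show ?case using gp_null_swap_left by (auto simp: gp_shape_def)
  qed
  then show ?thesis ..
qed

lemma gp_null_perm_right:
  assumes "mset ys = mset ys'" "gp_shape \<alpha> xs ys d" "gp_null \<alpha> xs ys"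
  shows "gp_null \<alpha> xs ys'"
proof -
  have "gp_shape \<alpha> xs ys d \<and> gp_null \<alpha> xs ys" using assms by simp
  with assms(1) have "gp_shape \<alpha> xs ys' d \<and> gp_null \<alpha> xs ys'"
  proof (induction rule: mset_swap_induct)
    case (swap ps a b qs)
    then have shape: "gp_shape \<alpha> xs (ps @ a # b # qs) d" and shape': "gp_shape \<alpha> xs (ps @ b # a # qs) d"
      by (auto simp: gp_shape_def)
    have "\<phi> ((\<alpha> @ xs ! k # ps) @ b # a # qs) = neg F (\<phi> ((\<alpha> @ xs ! k # ps) @ a # b # qs))"
      if "k < length xs" for k
      using shape that nth_mem[OF that] by (intro phi_swap) (auto simp: gp_shape_def subset_iff)
    then have "gp_term \<alpha> xs (ps @ b # a # qs) k = neg F (gp_term \<alpha> xs (ps @ a # b # qs) k)"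
      if "k < length xs" for k
      using that gp_factor_car[OF shape that] by (simp add: gp_term_def neg_sgnp)
    moreover have "null_sum (map (gp_term \<alpha> xs (ps @ a # b # qs)) [0..<length xs])"
      using swap by (simp add: gp_null_def)
    ultimately have "gp_null \<alpha> xs (ps @ b # a # qs)" unfolding gp_null_def
      using gp_term_car[OF shape]
      by - (rule null_sum_sgnp[where j = 1 and h = "gp_term \<alpha> xs (ps @ a # b # qs)"], simp_all)
    with shape' show ?case ..
  qed
  then show ?thesis ..
qed

end

text \<open>\<open>three_term\<close> asks for distinct entries because polarization supplies only
  those relations. \<open>\<B>\<close> may be empty, as a list of positions need not contain a
  basis.\<close>

locale weak_matroid_rep = alternating_fun +
  fixes \<B> :: "nat set set"
  assumes phi_support: "\<beta> \<in> idx m q \<Longrightarrow> \<phi> \<beta> \<noteq> tzero F \<longleftrightarrow> distinct \<beta> \<and> set \<beta> \<in> \<B>"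
    and bases: "B \<in> \<B> \<Longrightarrow> B \<subseteq> {..<m} \<and> card B = q"
    and exchange: "A \<in> \<B> \<Longrightarrow> B \<in> \<B> \<Longrightarrow> i \<in> A - B \<Longrightarrow>
      \<exists>j\<in>B - A. insert j (A - {i}) \<in> \<B> \<and> insert i (B - {j}) \<in> \<B>"
    and three_term: "gp_shape \<alpha> xs ys 1 \<Longrightarrow> distinct (\<alpha> @ xs @ ys) \<Longrightarrow> gp_null \<alpha> xs ys"
begin

lemma phi_eq_zero: "set \<beta> \<subseteq> {..<m} \<Longrightarrow> length \<beta> = q \<Longrightarrow> \<phi> \<beta> = \<zero> \<longleftrightarrow> \<not> (distinct \<beta> \<and> set \<beta> \<in> \<B>)"
  using phi_support[of \<beta>] by (auto simp: idx_def)

lemma phi_not_distinct: "set \<beta> \<subseteq> {..<m} \<Longrightarrow> length \<beta> = q \<Longrightarrow> \<not> distinct \<beta> \<Longrightarrow> \<phi> \<beta> = \<zero>"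
  by (simp add: phi_eq_zero)

lemma gp_left_eq_zero:
  assumes "gp_shape \<alpha> xs ys d" "distinct (\<alpha> @ xs)" "k < length xs"
  shows "\<phi> (\<alpha> @ rem k xs) = \<zero> \<longleftrightarrow> set \<alpha> \<union> set xs - {xs ! k} \<notin> \<B>"
proof -
  have "xs ! k \<notin> set \<alpha>" using assms(2,3) by (auto dest: nth_mem)
  then have "set (\<alpha> @ rem k xs) = set \<alpha> \<union> set xs - {xs ! k}" "distinct (\<alpha> @ rem k xs)"
    using assms set_rem_subset[of k xs] by (auto simp: set_rem distinct_rem)
  then show ?thesis using assms phi_eq_zero[of "\<alpha> @ rem k xs"]
    by (auto simp: gp_shape_def subset_iff)
qed

lemma gp_right_eq_zero:
  assumes "gp_shape \<alpha> xs ys d" "distinct (\<alpha> @ ys)" "k < length xs"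
  shows "\<phi> (\<alpha> @ xs ! k # ys) = \<zero> \<longleftrightarrow> insert (xs ! k) (set \<alpha> \<union> set ys) \<notin> \<B> \<or> xs ! k \<in> set \<alpha> \<union> set ys"
  using assms phi_eq_zero[of "\<alpha> @ xs ! k # ys"] nth_mem[of k xs]
  by (auto simp: gp_shape_def subset_iff)

lemma gp_null_zero: "(\<And>k. k < length xs \<Longrightarrow> gp_term \<alpha> xs ys k = \<zero>) \<Longrightarrow> gp_null \<alpha> xs ys"
  unfolding gp_null_def by (subst fs_all_zero) auto

lemma gp_term_zero_left: "gp_shape \<alpha> xs ys d \<Longrightarrow> k < length xs \<Longrightarrow> \<phi> (\<alpha> @ rem k xs) = \<zero> \<Longrightarrow> gp_term \<alpha> xs ys k = \<zero>"
  using gp_factor_car(2)[of \<alpha> xs ys d k] by (simp add: gp_term_def)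

lemma gp_term_zero_right: "gp_shape \<alpha> xs ys d \<Longrightarrow> k < length xs \<Longrightarrow> \<phi> (\<alpha> @ xs ! k # ys) = \<zero> \<Longrightarrow> gp_term \<alpha> xs ys k = \<zero>"
  using gp_factor_car(1)[of \<alpha> xs ys d k] by (simp add: gp_term_def)

section \<open>Reduction to distinct entries and induction on the length\<close>

definition gp_all :: "nat \<Rightarrow> bool" where
  "gp_all d \<longleftrightarrow> (\<forall>\<alpha> xs ys. gp_shape \<alpha> xs ys d \<longrightarrow> gp_null \<alpha> xs ys)"

lemma gp_all_0: "gp_all 0"
  unfolding gp_all_def
proof (intro allI impI)
  fix \<alpha> xs ys assume shape: "gp_shape \<alpha> xs ys 0"
  then obtain a b where [simp]: "xs = [a, b]" "ys = []"
    by (auto simp: gp_shape_def length_Suc_conv numeral_2_eq_2)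
  have "\<phi> (\<alpha> @ [a]) \<in> carr" "\<phi> (\<alpha> @ [b]) \<in> carr" using shape by (auto simp: gp_shape_def)
  then show "gp_null \<alpha> xs ys"
    using null_neg[of "\<phi> (\<alpha> @ [a]) \<odot> \<phi> (\<alpha> @ [b])"] mult_comm[of "\<phi> (\<alpha> @ [a])" "\<phi> (\<alpha> @ [b])"]
    by (simp add: gp_null_def gp_term_def)
qed

text \<open>With \<open>c\<close> at the front of both lists the first term vanishes. In every other
  term, moving \<open>c\<close> ahead of \<open>xs' ! k\<close> costs a sign, which cancels the
  shift of the index; what remains is the relation for \<open>\<alpha> @ [c]\<close>,
  \<open>xs'\<close>, \<open>ys'\<close>.\<close>

lemma gp_null_share:
  assumes all: "gp_all d" and shape: "gp_shape \<alpha> xs ys (Suc d)" and c: "c \<in> set xs" "c \<in> set ys"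
  shows "gp_null \<alpha> xs ys"
proof -
  obtain xs' ys' where perm: "mset (c # xs') = mset xs" "mset (c # ys') = mset ys"
    using c by (metis ex_mset mset.simps(2) insert_DiffM set_mset_mset)
  then have sets: "set xs = insert c (set xs')" "set ys = insert c (set ys')"
    and len: "length xs = Suc (length xs')" "length ys = Suc (length ys')"
    by (metis list.simps(15) mset_eq_setD) (metis list.simps(15) mset_eq_setD perm(2), metis length_Cons mset_eq_length perm(1), metis length_Cons mset_eq_length perm(2))
  have shape': "gp_shape \<alpha> (c # xs') (c # ys') (Suc d)" and shape'': "gp_shape (\<alpha> @ [c]) xs' ys' d"
    and shape3: "gp_shape \<alpha> xs (c # ys') (Suc d)"
    using shape sets len by (auto simp: gp_shape_def)
  have null: "null_sum (map (gp_term (\<alpha> @ [c]) xs' ys') [0..<length xs'])"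
    using all shape'' by (simp add: gp_all_def gp_null_def)
  have first: "gp_term \<alpha> (c # xs') (c # ys') 0 = \<zero>"
    using shape' by (intro gp_term_zero_right phi_not_distinct) (auto simp: gp_shape_def)
  have rest: "gp_term \<alpha> (c # xs') (c # ys') (Suc k) = gp_term (\<alpha> @ [c]) xs' ys' k" if "k < length xs'" for k
  proof -
    have "\<phi> (\<alpha> @ xs' ! k # c # ys') = neg F (\<phi> (\<alpha> @ c # xs' ! k # ys'))"
      using shape'' that nth_mem[OF that] by (intro phi_swap) (auto simp: gp_shape_def subset_iff)
    then show ?thesis using gp_factor_car[OF shape'' that] by (simp add: gp_term_def neg_sgnp)
  qed
  have "map (gp_term \<alpha> (c # xs') (c # ys')) [0..<length (c # xs')] = \<zero> # map (gp_term (\<alpha> @ [c]) xs' ys') [0..<length xs']"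
    using first rest by (simp add: upt_conv_Cons map_Suc_upt[symmetric] o_def del: upt_Suc)
  then have "gp_null \<alpha> (c # xs') (c # ys')" using null by (simp add: gp_null_def fs_def)
  then have "gp_null \<alpha> xs (c # ys')" by (rule gp_null_perm_left[OF perm(1) shape'])
  then show ?thesis by (rule gp_null_perm_right[OF perm(2) shape3])
qed

text \<open>With both copies of \<open>c\<close> in front, the first two terms are the same product
  with opposite signs; all other terms keep both copies in the left factor and vanish.\<close>

lemma gp_null_repeat:
  assumes shape: "gp_shape \<alpha> xs ys d" and repeat: "\<not> distinct xs"
  shows "gp_null \<alpha> xs ys"
proof -
  obtain us vs ws c where xs: "xs = us @ [c] @ vs @ [c] @ ws"
    using repeat not_distinct_decomp by blast
  define zs where "zs = us @ vs @ ws"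
  have perm: "mset (c # c # zs) = mset xs" by (simp add: xs zs_def)
  have shape': "gp_shape \<alpha> (c # c # zs) ys d" using shape by (auto simp: gp_shape_def xs zs_def)
  have rest: "gp_term \<alpha> (c # c # zs) ys (Suc (Suc k)) = \<zero>" if "k < length zs" for k
    using shape' that set_rem_subset[of k zs]
    by (intro gp_term_zero_left phi_not_distinct) (auto simp: gp_shape_def subset_iff)
  have "gp_term \<alpha> (c # c # zs) ys 1 = neg F (gp_term \<alpha> (c # c # zs) ys 0)"
    by (simp add: gp_term_def)
  then have "null_sum [gp_term \<alpha> (c # c # zs) ys 0, gp_term \<alpha> (c # c # zs) ys 1]"
    using null_neg[OF gp_term_car[OF shape', of 0]] by simp
  moreover have "[0..<length (c # c # zs)] = [0, 1] @ map (\<lambda>k. Suc (Suc k)) [0..<length zs]"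
    by (simp add: upt_conv_Cons map_Suc_upt[symmetric] o_def del: upt_Suc)
  moreover have "fs F (map (gp_term \<alpha> (c # c # zs) ys) (map (\<lambda>k. Suc (Suc k)) [0..<length zs])) = {#}"
    using rest by (intro fs_all_zero) auto
  ultimately have "gp_null \<alpha> (c # c # zs) ys"
    by (simp only: gp_null_def map_append fs_append) simp
  then show ?thesis by (rule gp_null_perm_left[OF perm shape'])
qed

lemma gp_all_SucI:
  assumes all: "gp_all d"
    and dist: "\<And>\<alpha> xs ys. gp_shape \<alpha> xs ys (Suc d) \<Longrightarrow> distinct (\<alpha> @ xs @ ys) \<Longrightarrow> gp_null \<alpha> xs ys"
  shows "gp_all (Suc d)"
  unfolding gp_all_def
proof (intro allI impI)
  fix \<alpha> xs ys assume shape: "gp_shape \<alpha> xs ys (Suc d)"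
  consider "distinct (\<alpha> @ xs @ ys)" | "\<not> distinct xs" | "set xs \<inter> set ys \<noteq> {}"
    | "\<not> distinct (\<alpha> @ ys)" | c where "c \<in> set \<alpha>" "c \<in> set xs" "distinct xs" by auto
  then show "gp_null \<alpha> xs ys"
  proof cases
    case 1
    with dist shape show ?thesis by blast
  next
    case 2
    with gp_null_repeat shape show ?thesis by blast
  next
    case 3
    with gp_null_share[OF all shape] show ?thesis by blast
  next
    case 4
    have "gp_term \<alpha> xs ys k = \<zero>" if "k < length xs" for k
      using 4 shape that nth_mem[OF that]
      by (intro gp_term_zero_right phi_not_distinct) (auto simp: gp_shape_def subset_iff)
    then show ?thesis by (rule gp_null_zero)
  next
    \<comment> \<open>The term that drops \<open>c\<close> from \<open>xs\<close> has
      \<open>c\<close> twice in its right factor, every other term has it twice in its left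
      factor.\<close>
    case (5 c)
    have "gp_term \<alpha> xs ys k = \<zero>" if k: "k < length xs" for k
    proof (cases "xs ! k = c")
      case True
      then show ?thesis using 5 shape k
        by (intro gp_term_zero_right phi_not_distinct) (auto simp: gp_shape_def subset_iff)
    next
      case False
      then have "c \<in> set (rem k xs)" using 5 k by (simp add: set_rem)
      then show ?thesis using 5 shape k set_rem_subset[of k xs]
        by (intro gp_term_zero_left phi_not_distinct) (auto simp: gp_shape_def subset_iff)
    qed
    then show ?thesis by (rule gp_null_zero)
  qed
qed

lemma gp_all_1: "gp_all 1"
  using gp_all_SucI[OF gp_all_0] three_term by simp

text \<open>The three-term relations are the start, so a step handles right-hand lists of length at
  least two.\<close>

lemma gp_all_induct:
  assumes step: "\<And>d \<alpha> xs ys. gp_all (Suc d) \<Longrightarrow> gp_shape \<alpha> xs ys (Suc (Suc d)) \<Longrightarrow>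
    distinct (\<alpha> @ xs @ ys) \<Longrightarrow> gp_null \<alpha> xs ys"
  shows "gp_all d"
proof -
  have "gp_all (Suc d)" for d
  proof (induction d)
    case 0
    show ?case using gp_all_1 by simp
  next
    case (Suc d)
    from this step[OF this] show ?case by (rule gp_all_SucI)
  qed
  then show ?thesis using gp_all_0 by (cases d) auto
qed

end

section \<open>Perfect tracts\<close>

lemma Sig_eq_of_bool_iff: "Sig \<beta> = (\<lambda>e. of_bool (e \<in> S)) \<longleftrightarrow> distinct \<beta> \<and> set \<beta> = S"
proof
  assume eq: "Sig \<beta> = (\<lambda>e. of_bool (e \<in> S))"
  then have count: "count (mset \<beta>) e = of_bool (e \<in> S)" for e by (metis Sig_def)
  then have S: "set \<beta> = S" by (auto simp flip: count_greater_zero_iff set_mset_mset)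
  with count show "distinct \<beta> \<and> set \<beta> = S" by (auto simp: distinct_count_atmost_1)
next
  assume "distinct \<beta> \<and> set \<beta> = S"
  then show "Sig \<beta> = (\<lambda>e. of_bool (e \<in> S))" by (auto simp: Sig_def distinct_count_atmost_1)
qed

lemma matroid_of_bases:
  assumes ne: "\<C> \<noteq> {}" and sub: "\<And>S. S \<in> \<C> \<Longrightarrow> S \<subseteq> {..<n} \<and> card S = r"
    and exch: "\<And>S T i. S \<in> \<C> \<Longrightarrow> T \<in> \<C> \<Longrightarrow> i \<in> S - T \<Longrightarrow>
      \<exists>j\<in>T - S. insert j (S - {i}) \<in> \<C> \<and> insert i (T - {j}) \<in> \<C>"
  shows "matroid n r ((\<lambda>S e. of_bool (e \<in> S)) ` \<C>)"
proof -
  let ?\<chi> = "\<lambda>S e. of_bool (e \<in> S) :: nat"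
  have "?\<chi> S \<in> Delta r n" if "S \<in> \<C>" for S
  proof -
    have "{..<n} \<inter> S = S" using sub[OF that] by auto
    then show ?thesis using sub[OF that] by (auto simp: Delta_def sum_of_bool_eq)
  qed
  moreover have "\<exists>j. ?\<chi> S j < ?\<chi> T j \<and> (?\<chi> S)(i := ?\<chi> S i - 1, j := ?\<chi> S j + 1) \<in> ?\<chi> ` \<C>
      \<and> (?\<chi> T)(i := ?\<chi> T i + 1, j := ?\<chi> T j - 1) \<in> ?\<chi> ` \<C>"
    if ST: "S \<in> \<C>" "T \<in> \<C>" and "?\<chi> T i < ?\<chi> S i" for S T i
  proof -
    have i: "i \<in> S - T" using that(3) by (auto split: if_splits simp: of_bool_def)
    from exch[OF ST i] obtain j where j: "j \<in> T - S" "insert j (S - {i}) \<in> \<C>" "insert i (T - {j}) \<in> \<C>" by blast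
    have "(?\<chi> S)(i := ?\<chi> S i - 1, j := ?\<chi> S j + 1) = ?\<chi> (insert j (S - {i}))"
      "(?\<chi> T)(i := ?\<chi> T i + 1, j := ?\<chi> T j - 1) = ?\<chi> (insert i (T - {j}))"
      using i j(1) by (auto simp: fun_eq_iff)
    moreover have "?\<chi> S j < ?\<chi> T j" using j(1) by simp
    ultimately show ?thesis using j(2,3) by blast
  qed
  ultimately show ?thesis
    using ne unfolding matroid_def m_convex_def by (auto simp: of_bool_def)
qed

context tract_laws
begin

lemma Cfun_nth: "distinct y \<Longrightarrow> k < length y \<Longrightarrow> Cfun F \<psi> y (y ! k) = neg F (sgnp F k (\<psi> (rem k y)))"
proof -
  assume y: "distinct y" "k < length y"
  then have "(THE p. p < length y \<and> y ! p = y ! k) = k"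
    by (auto simp: nth_eq_iff_index_eq)
  then show ?thesis using y by (simp add: Cfun_def)
qed

lemma Cfun_car:
  assumes "distinct y" "\<And>k. k < length y \<Longrightarrow> \<psi> (rem k y) \<in> carr"
  shows "Cfun F \<psi> y e \<in> carr"
proof (cases "e \<in> set y")
  case True
  then obtain k where "k < length y" "y ! k = e" by (auto simp: in_set_conv_nth)
  then show ?thesis using assms Cfun_nth[of y k \<psi>] by auto
qed (simp add: Cfun_def)

text \<open>Turns orthogonality to a circuit into the shape of a Grassmann-Pluecker sum. The global
  sign arises because \<open>Cfun\<close> counts positions from 1 and \<open>gp_term\<close> from
  0.\<close>

lemma null_sum_Cfun_iff:
  assumes y: "distinct y" "set y \<subseteq> {..<n}" and psi: "\<And>k. k < length y \<Longrightarrow> \<psi> (rem k y) \<in> carr"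
    and Y: "\<And>e. e < n \<Longrightarrow> Y e \<in> carr"
  shows "null_sum (map (\<lambda>e. Y e \<odot> Cfun F \<psi> y e) [0..<n]) \<longleftrightarrow>
    null_sum (map (\<lambda>k. sgnp F k (\<psi> (rem k y) \<odot> Y (y ! k))) [0..<length y])"
    (is "?L \<longleftrightarrow> null_sum (map ?h [0..<length y])")
proof -
  let ?g = "\<lambda>e. Y e \<odot> Cfun F \<psi> y e"
  have "fs F (map ?g [0..<n]) = fs F (map ?g y)"
  proof (rule fs_map_support[OF y])
    fix a assume "a < n" "a \<notin> set y"
    then show "?g a = \<zero>" using mult_zero[OF Y] by (simp add: Cfun_def)
  qed
  moreover have "map ?g y = map (\<lambda>k. ?g (y ! k)) [0..<length y]" by (rule nth_equalityI) simp_all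
  ultimately have L: "?L \<longleftrightarrow> null_sum (map (\<lambda>k. ?g (y ! k)) [0..<length y])" by simp
  have car: "?h k \<in> carr" and eq: "?g (y ! k) = neg F (?h k)" if "k < length y" for k
  proof -
    have "y ! k < n" using y that nth_mem by blast
    then show "?h k \<in> carr" "?g (y ! k) = neg F (?h k)" using psi Y that y mult_comm[of "Y (y ! k)" "\<psi> (rem k y)"]
      by (simp_all add: Cfun_nth)
  qed
  show ?thesis unfolding L
  proof
    assume a: "null_sum (map (\<lambda>k. ?g (y ! k)) [0..<length y])"
    show "null_sum (map ?h [0..<length y])"
      by (rule null_sum_sgnp[OF a, where j = 1]) (use car eq in auto)
  next
    assume a: "null_sum (map ?h [0..<length y])"
    show "null_sum (map (\<lambda>k. ?g (y ! k)) [0..<length y])"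
      by (rule null_sum_sgnp[OF a, where j = 1]) (use car eq in auto)
  qed
qed

end

context weak_matroid_rep
begin

text \<open>The minor keeps the ground set \<open>{..<m}\<close>: outside \<open>set xs\<close>
  there are only loops, as \<open>\<psi>\<close> vanishes on lists that leave \<open>set xs\<close>.
  Its rank is \<open>d + 2\<close>. \<open>X\<close> comes from a circuit of the contraction by
  \<open>\<alpha>\<close> alone, so contracting \<open>e\<close> as well leaves it a vector that
  need not be a circuit; \<open>Y\<close> comes from \<open>ys\<close>, which contains
  \<open>e\<close>, and this is why it survives the contraction.\<close>

lemma perfect_gp_step:
  assumes perf: "perfect F" and all: "gp_all (Suc d)"
    and shape: "gp_shape \<alpha> xs ys (Suc (Suc d))" and dist: "distinct (\<alpha> @ xs @ ys)"
  shows "gp_null \<alpha> xs ys"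
proof (cases "\<forall>k<length xs. gp_term \<alpha> xs ys k = \<zero>")
  case True
  then show ?thesis by (intro gp_null_zero) auto
next
  case False
  \<comment> \<open>A family of bases of a matroid must be nonempty. The nonzero term provides two
    bases, and exchanging \<open>e\<close> between them yields a basis that contains
    \<open>\<alpha>\<close> and \<open>e\<close> and otherwise only entries of
    \<open>xs\<close>.\<close>
  then obtain k0 where k0: "k0 < length xs" "gp_term \<alpha> xs ys k0 \<noteq> \<zero>" by blast
  obtain e ys' where ys: "ys = e # ys'" using shape by (auto simp: gp_shape_def length_Suc_conv)
  have dists: "distinct (\<alpha> @ xs)" "distinct (\<alpha> @ ys)" "distinct xs" using dist by auto
  have bounds: "set \<alpha> \<subseteq> {..<m}" "set xs \<subseteq> {..<m}" "set ys' \<subseteq> {..<m}" "e < m"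
    and lens: "length \<alpha> + d + 3 = q" "length xs = d + 4" "length ys' = d + 1"
    using shape by (auto simp: gp_shape_def ys)
  have e: "e \<notin> set \<alpha>" "e \<notin> set xs" "set \<alpha> \<inter> set xs = {}" using dist by (auto simp: ys)
  define c where "c = insert e (set \<alpha>)"
  have c: "c \<inter> set xs = {}" "finite c" "card c + d + 2 = q"
    using e lens dists by (auto simp: c_def distinct_card)
  define \<C> where "\<C> = {S. S \<subseteq> set xs \<and> S \<union> c \<in> \<B>}"
  define \<psi> where "\<psi> \<beta> = (if set \<beta> \<subseteq> set xs then \<phi> (\<alpha> @ e # \<beta>) else \<zero>)" for \<beta>
  have psi_car: "\<psi> \<beta> \<in> carr" if "length \<beta> = d + 2" for \<beta>
    using that bounds lens by (auto simp: \<psi>_def)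
  have rem_sub: "set (rem k zs) \<subseteq> set xs" if "set zs \<subseteq> set xs" for k zs
    using set_rem_subset that by (rule subset_trans)
  have matroid: "matroid m (d + 2) ((\<lambda>S e. of_bool (e \<in> S)) ` \<C>)"
  proof (rule matroid_of_bases)
    let ?x = "xs ! k0"
    have x: "?x \<in> set xs" using k0 by simp
    have "\<phi> (\<alpha> @ rem k0 xs) \<noteq> \<zero>" "\<phi> (\<alpha> @ ?x # ys) \<noteq> \<zero>"
      using k0 gp_term_zero_left[OF shape] gp_term_zero_right[OF shape] by blast+
    then have bs: "insert ?x (set \<alpha> \<union> set ys) \<in> \<B>" "set \<alpha> \<union> set xs - {?x} \<in> \<B>"
      using gp_left_eq_zero[OF shape dists(1) k0(1)] gp_right_eq_zero[OF shape dists(2) k0(1)] by blast+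
    have "e \<in> insert ?x (set \<alpha> \<union> set ys) - (set \<alpha> \<union> set xs - {?x})" using e by (simp add: ys)
    from exchange[OF bs this] obtain j where
      j: "j \<in> set \<alpha> \<union> set xs - {?x} - insert ?x (set \<alpha> \<union> set ys)" "insert e (set \<alpha> \<union> set xs - {?x} - {j}) \<in> \<B>"
      by blast
    have "insert e (set \<alpha> \<union> set xs - {?x} - {j}) = (set xs - {?x, j}) \<union> c"
      using j(1) x e by (auto simp: c_def)
    with j(2) have "set xs - {?x, j} \<in> \<C>" by (auto simp: \<C>_def)
    then show "\<C> \<noteq> {}" by blast
  next
    fix S assume "S \<in> \<C>"
    then have S: "S \<subseteq> set xs" "card (S \<union> c) = q" using bases by (auto simp: \<C>_def)
    moreover have "finite S" "S \<inter> c = {}" using S(1) c(1) by (auto intro: finite_subset)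
    ultimately have "card S + card c = q" using c(2) card_Un_disjoint[of S c] by simp
    with c S bounds show "S \<subseteq> {..<m} \<and> card S = d + 2" by auto
  next
    fix S T i assume S: "S \<in> \<C>" and T: "T \<in> \<C>" and i: "i \<in> S - T"
    then have ic: "i \<notin> c" using c by (auto simp: \<C>_def)
    from exchange[of "S \<union> c" "T \<union> c" i] S T i ic obtain j where
      j: "j \<in> T \<union> c - (S \<union> c)" "insert j (S \<union> c - {i}) \<in> \<B>" "insert i (T \<union> c - {j}) \<in> \<B>"
      by (auto simp: \<C>_def)
    have "insert j (S \<union> c - {i}) = insert j (S - {i}) \<union> c" "insert i (T \<union> c - {j}) = insert i (T - {j}) \<union> c"
      using ic j(1) by auto
    with S T i j show "\<exists>j\<in>T - S. insert j (S - {i}) \<in> \<C> \<and> insert i (T - {j}) \<in> \<C>"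
      by (intro bexI[of _ j]) (auto simp: \<C>_def)
  qed
  have alt: "alternating F m (d + 2) \<psi>"
    unfolding alternating_def
  proof (intro ballI allI impI)
    fix \<beta> i j assume \<beta>: "\<beta> \<in> idx m (d + 2)" and ij: "i < d + 2 \<and> j < d + 2 \<and> i \<noteq> j"
    let ?\<beta>' = "\<beta>[i := \<beta> ! j, j := \<beta> ! i]"
    define p where "p = \<alpha> @ [e]"
    have set: "set ?\<beta>' = set \<beta>" using ij \<beta> by (intro set_swap) (auto simp: idx_def)
    have mem: "p @ \<beta> \<in> idx m q" using \<beta> bounds lens by (auto simp: idx_def p_def)
    have "length p + i < q" "length p + j < q" using ij lens by (auto simp: p_def)
    then have "\<phi> ((p @ \<beta>)[length p + i := (p @ \<beta>) ! (length p + j), length p + j := (p @ \<beta>) ! (length p + i)])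
        = neg F (\<phi> (p @ \<beta>))"
      using phi_alt[unfolded alternating_def, THEN bspec, OF mem, rule_format, of "length p + i" "length p + j"] ij
      by simp
    then have "\<phi> (p @ ?\<beta>') = neg F (\<phi> (p @ \<beta>))" by (simp add: list_update_append)
    then show "\<psi> ?\<beta>' = neg F (\<psi> \<beta>)" using set by (simp add: \<psi>_def p_def)
  qed
  have gp: "strong_gp F m (d + 2) ((\<lambda>S e. of_bool (e \<in> S)) ` \<C>) \<psi>"
    unfolding strong_gp_def
  proof (intro conjI ballI impI alt)
    fix \<beta> assume \<beta>: "\<beta> \<in> idx m (d + 2)"
    then show "\<psi> \<beta> \<in> carr" using psi_car by (simp add: idx_def)
    have "\<phi> (\<alpha> @ e # \<beta>) \<noteq> \<zero> \<longleftrightarrow> distinct \<beta> \<and> set \<beta> \<in> \<C>" if "set \<beta> \<subseteq> set xs"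
    proof -
      have "set (\<alpha> @ e # \<beta>) = set \<beta> \<union> c" by (auto simp: c_def)
      moreover have "distinct (\<alpha> @ e # \<beta>) \<longleftrightarrow> distinct \<beta>" using that dists e by auto
      ultimately show ?thesis using that \<beta> bounds lens
        by (subst phi_eq_zero) (auto simp: idx_def \<C>_def)
    qed
    moreover have "Sig \<beta> \<in> (\<lambda>S e. of_bool (e \<in> S)) ` \<C> \<longleftrightarrow> distinct \<beta> \<and> set \<beta> \<in> \<C>"
      using Sig_eq_of_bool_iff by (auto simp: image_iff)
    ultimately show "\<psi> \<beta> \<noteq> \<zero> \<longleftrightarrow> Sig \<beta> \<in> (\<lambda>S e. of_bool (e \<in> S)) ` \<C>"
      by (auto simp: \<psi>_def \<C>_def)
  next
    fix x y assume x: "x \<in> idx m (d + 2 + 1)" and y: "y \<in> idx m (d + 2 - 1)"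
    show "null_sum (map (\<lambda>k. sgnp F k (\<psi> (rem k x) \<odot> \<psi> (x ! k # y))) [0..<d + 2 + 1])"
    proof (cases "set x \<subseteq> set xs \<and> set y \<subseteq> set xs")
      \<comment> \<open>The relation for \<open>\<psi>\<close> is the one for \<open>\<phi>\<close>
        with prefix \<open>\<alpha> @ [e]\<close>, whose right-hand list is one shorter than
        \<open>ys\<close>.\<close>
      case True
      have "gp_shape (\<alpha> @ [e]) x y (Suc d)" using x y bounds lens by (auto simp: gp_shape_def idx_def)
      then have "gp_null (\<alpha> @ [e]) x y" using all by (simp add: gp_all_def)
      moreover have "gp_term (\<alpha> @ [e]) x y k = sgnp F k (\<psi> (rem k x) \<odot> \<psi> (x ! k # y))" if "k < length x" for k
      proof -
        have "x ! k \<in> set xs" using True that nth_mem by blast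
        then show ?thesis using True rem_sub[of x k] by (auto simp: gp_term_def \<psi>_def)
      qed
      then have "map (gp_term (\<alpha> @ [e]) x y) [0..<length x] =
          map (\<lambda>k. sgnp F k (\<psi> (rem k x) \<odot> \<psi> (x ! k # y))) [0..<length x]"
        by (intro map_cong) auto
      moreover have "length x = d + 2 + 1" using x by (simp add: idx_def)
      ultimately show ?thesis unfolding gp_null_def by metis
    next
      case False
      have "\<psi> (rem k x) = \<zero> \<or> \<psi> (x ! k # y) = \<zero>" if k: "k < length x" for k
      proof (rule ccontr)
        assume "\<not> ?thesis"
        then have "set (rem k x) \<subseteq> set xs" "x ! k \<in> set xs" "set y \<subseteq> set xs" by (auto simp: \<psi>_def split: if_splits)
        moreover have "set x \<subseteq> insert (x ! k) (set (rem k x))"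
          using id_take_nth_drop[OF k] by (metis Un_insert_right list.simps(15) order_refl rem_def set_append)
        ultimately show False using False by auto
      qed
      moreover have "\<psi> (rem k x) \<in> carr" "\<psi> (x ! k # y) \<in> carr" if "k < length x" for k
        using that x y by (auto simp: idx_def intro!: psi_car)
      ultimately have "sgnp F k (\<psi> (rem k x) \<odot> \<psi> (x ! k # y)) = \<zero>" if "k < length x" for k
        using that by auto
      then show ?thesis using x by (subst fs_all_zero) (auto simp: idx_def simp del: upt_Suc)
    qed
  qed
  define X where "X = Cfun F (\<lambda>\<beta>. \<phi> (\<alpha> @ \<beta>)) xs"
  define Y where "Y a = (if a \<in> set xs then \<phi> (\<alpha> @ a # ys) else \<zero>)" for a
  have X_car: "X a \<in> carr" for a
    unfolding X_def using gp_factor_car[OF shape] dists by (intro Cfun_car) auto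
  have Y_car: "Y a \<in> carr" for a
    using bounds lens by (auto simp: Y_def ys)
  have "is_vector F m (d + 2) \<psi> X"
    unfolding is_vector_def
  proof (intro conjI allI impI ballI X_car)
    fix z assume z: "z \<in> idx m (d + 2 - 1)"
    have D_car: "Dfun \<psi> z a \<in> carr" for a using z by (auto simp: Dfun_def idx_def intro!: psi_car)
    have "null_sum (map (\<lambda>k. sgnp F k (\<phi> (\<alpha> @ rem k xs) \<odot> Dfun \<psi> z (xs ! k))) [0..<length xs])"
    proof (cases "set z \<subseteq> set xs")
      case True
      have shape_z: "gp_shape \<alpha> xs (e # z) (Suc (Suc d))" using z bounds lens by (auto simp: gp_shape_def idx_def)
      \<comment> \<open>\<open>z\<close> has \<open>d + 1\<close> entries, so a first one exists;
        lying in \<open>xs\<close>, it is shared by both lists.\<close>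
      obtain a z' where "z = a # z'" using z by (auto simp: idx_def length_Suc_conv)
      then have "gp_null \<alpha> xs (e # z)" using True by (intro gp_null_share[OF all shape_z, of a]) auto
      \<comment> \<open>\<open>Dfun\<close> puts its argument last; moving it there from the front
        passes the \<open>d + 2\<close> entries of \<open>e # z\<close>.\<close>
      moreover have "Dfun \<psi> z (xs ! k) = sgnp F (d + 2) (\<phi> (\<alpha> @ xs ! k # e # z))" if k: "k < length xs" for k
        using phi_move[of \<alpha> "xs ! k" "e # z" "[]"] True k nth_mem[OF k] z bounds lens
        by (auto simp: Dfun_def \<psi>_def idx_def subset_iff)
      then have "sgnp F k (\<phi> (\<alpha> @ rem k xs) \<odot> Dfun \<psi> z (xs ! k)) = sgnp F (d + 2) (gp_term \<alpha> xs (e # z) k)"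
        if k: "k < length xs" for k
        using k gp_factor_car[OF shape_z k] by (simp only: gp_term_def mult_sgnp_right sgnp_comm)
      ultimately show ?thesis using gp_term_car[OF shape_z] unfolding gp_null_def
        by - (rule null_sum_sgnp[where j = "d + 2" and h = "gp_term \<alpha> xs (e # z)"], simp_all del: upt_Suc sgnp_simps add_2_eq_Suc')
    next
      case False
      then have "Dfun \<psi> z a = \<zero>" for a by (auto simp: Dfun_def \<psi>_def)
      then show ?thesis using gp_factor_car(1)[OF shape] by (subst fs_all_zero) auto
    qed
    then have "null_sum (map (\<lambda>a. Dfun \<psi> z a \<odot> X a) [0..<m])"
      using dists bounds D_car gp_factor_car(1)[OF shape] unfolding X_def by (subst null_sum_Cfun_iff) auto
    then show "null_sum (map (\<lambda>a. X a \<odot> Dfun \<psi> z a) [0..<m])"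
      using X_car D_car by (simp only: mult_comm cong: map_cong)
  qed
  moreover have "is_covector F m (d + 2) \<psi> Y"
    unfolding is_covector_def
  proof (intro conjI allI impI ballI Y_car)
    fix y assume y: "y \<in> idx m (d + 2 + 1)" "distinct y"
    have rem_car: "\<psi> (rem k y) \<in> carr" if "k < length y" for k
      using that y by (intro psi_car) (auto simp: idx_def)
    have "null_sum (map (\<lambda>k. sgnp F k (\<psi> (rem k y) \<odot> Y (y ! k))) [0..<length y])"
    proof (cases "set y \<subseteq> set xs")
      case True
      \<comment> \<open>Moving \<open>e\<close> into the prefix shortens the right-hand list from
        \<open>ys\<close> to \<open>ys'\<close>; the swap of \<open>e\<close> with
        \<open>y ! k\<close> gives one global sign.\<close>
      have shape_y: "gp_shape (\<alpha> @ [e]) y ys' (Suc d)" using y bounds lens by (auto simp: gp_shape_def idx_def)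
      then have "gp_null (\<alpha> @ [e]) y ys'" using all by (simp add: gp_all_def)
      moreover have "sgnp F k (\<psi> (rem k y) \<odot> Y (y ! k)) = sgnp F 1 (gp_term (\<alpha> @ [e]) y ys' k)"
        if k: "k < length y" for k
      proof -
        have "y ! k \<in> set xs" using k True nth_mem by blast
        then have "Y (y ! k) = neg F (\<phi> ((\<alpha> @ [e]) @ y ! k # ys'))"
          using phi_swap[of \<alpha> e "y ! k" ys'] bounds lens by (auto simp: Y_def ys)
        then show ?thesis using gp_factor_car[OF shape_y k] rem_sub[OF True, of k]
          by (simp add: gp_term_def \<psi>_def neg_sgnp)
      qed
      ultimately show ?thesis using gp_term_car[OF shape_y] unfolding gp_null_def
        by - (rule null_sum_sgnp[where j = 1 and h = "gp_term (\<alpha> @ [e]) y ys'"], simp_all del: upt_Suc sgnp_simps)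
    next
      case False
      then obtain z where z: "z \<in> set y" "z \<notin> set xs" by blast
      have "\<psi> (rem k y) = \<zero> \<or> Y (y ! k) = \<zero>" if k: "k < length y" for k
        using z set_rem[OF y(2) k] by (cases "y ! k = z") (auto simp: \<psi>_def Y_def)
      then show ?thesis using rem_car Y_car by (subst fs_all_zero) auto
    qed
    then show "null_sum (map (\<lambda>a. Y a \<odot> Cfun F \<psi> y a) [0..<m])"
      using y rem_car Y_car by (subst null_sum_Cfun_iff) (auto simp: idx_def)
  qed
  ultimately have "null_sum (map (\<lambda>a. X a \<odot> Y a) [0..<m])"
    using perf matroid gp unfolding perfect_def by blast
  then have "null_sum (map (\<lambda>a. Y a \<odot> Cfun F (\<lambda>\<beta>. \<phi> (\<alpha> @ \<beta>)) xs a) [0..<m])"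
    using X_car Y_car by (simp only: mult_comm X_def cong: map_cong)
  \<comment> \<open>Reading \<open>X\<close> as a circuit function turns the pairing into the
    relation sought, since \<open>Y (xs ! k)\<close> is its right factor.\<close>
  then have "null_sum (map (\<lambda>k. sgnp F k (\<phi> (\<alpha> @ rem k xs) \<odot> Y (xs ! k))) [0..<length xs])"
    using dists bounds Y_car gp_factor_car(1)[OF shape] by (subst (asm) null_sum_Cfun_iff) auto
  moreover have "map (\<lambda>k. sgnp F k (\<phi> (\<alpha> @ rem k xs) \<odot> Y (xs ! k))) [0..<length xs] =
      map (gp_term \<alpha> xs ys) [0..<length xs]"
    by (intro map_cong) (auto simp: gp_term_def Y_def)
  ultimately show ?thesis unfolding gp_null_def by simp
qed

lemma perfect_gp_all: "perfect F \<Longrightarrow> gp_all d"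
  by (rule gp_all_induct, rule perfect_gp_step)

end

section \<open>Degenerate tracts\<close>

context weak_matroid_rep
begin

text \<open>Once all other terms vanish, uniqueness of negatives makes the relation an equation
  between two products, which can be multiplied and cancelled.\<close>

lemma gp_null_two_terms:
  assumes shape: "gp_shape \<alpha> (u # v # R) ys d" and dist: "distinct (\<alpha> @ u # v # R)" "distinct (\<alpha> @ ys)"
    and rest: "\<And>k. k \<in> set R \<Longrightarrow> set \<alpha> \<union> set (u # v # R) - {k} \<notin> \<B> \<or> insert k (set \<alpha> \<union> set ys) \<notin> \<B>"
  shows "gp_null \<alpha> (u # v # R) ys \<longleftrightarrow> \<phi> (\<alpha> @ v # R) \<odot> \<phi> (\<alpha> @ u # ys) = \<phi> (\<alpha> @ u # R) \<odot> \<phi> (\<alpha> @ v # ys)"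
proof -
  let ?a = "\<phi> (\<alpha> @ v # R) \<odot> \<phi> (\<alpha> @ u # ys)" and ?b = "\<phi> (\<alpha> @ u # R) \<odot> \<phi> (\<alpha> @ v # ys)"
  have car: "?a \<in> carr" "?b \<in> carr"
    using gp_factor_car[OF shape, of 0] gp_factor_car[OF shape, of 1] by simp_all
  have "gp_term \<alpha> (u # v # R) ys (Suc (Suc k)) = \<zero>" if k: "k < length R" for k
  proof -
    have k': "Suc (Suc k) < length (u # v # R)" using k by simp
    consider "set \<alpha> \<union> set (u # v # R) - {R ! k} \<notin> \<B>" | "insert (R ! k) (set \<alpha> \<union> set ys) \<notin> \<B>"
      using rest k nth_mem by blast
    then show ?thesis
    proof cases
      case 1
      then show ?thesis using gp_left_eq_zero[OF shape dist(1) k'] gp_term_zero_left[OF shape k'] by simp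
    next
      case 2
      then show ?thesis using gp_right_eq_zero[OF shape dist(2) k'] gp_term_zero_right[OF shape k'] by simp
    qed
  qed
  then have "fs F (map (gp_term \<alpha> (u # v # R) ys) (map (\<lambda>k. Suc (Suc k)) [0..<length R])) = {#}"
    by (intro fs_all_zero) auto
  moreover have "[0..<length (u # v # R)] = [0, 1] @ map (\<lambda>k. Suc (Suc k)) [0..<length R]"
    by (simp add: upt_conv_Cons map_Suc_upt[symmetric] o_def del: upt_Suc)
  ultimately have "gp_null \<alpha> (u # v # R) ys \<longleftrightarrow> null_sum [?a, neg F ?b]"
    by (simp only: gp_null_def map_append fs_append) (simp add: gp_term_def)
  also have "\<dots> \<longleftrightarrow> ?a = ?b"
    using car null_neg[of ?a] neg_unique[of ?a "neg F ?b"] by auto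
  finally show ?thesis .
qed

lemma gp_null_three_nonzero:
  assumes deg: "degenerate F" and shape: "gp_shape \<alpha> (u # v # w # R) ys d"
    and nz: "\<And>k. k < 3 \<Longrightarrow> gp_term \<alpha> (u # v # w # R) ys k \<noteq> \<zero>"
  shows "gp_null \<alpha> (u # v # w # R) ys"
proof -
  let ?T = "map (gp_term \<alpha> (u # v # w # R) ys) [0..<length (u # v # w # R)]"
  have "[0..<length (u # v # w # R)] = [0, 1, 2] @ [3..<length (u # v # w # R)]"
    by (simp add: upt_conv_Cons numeral_2_eq_2 numeral_3_eq_3 del: upt_Suc)
  then have "fs F ?T = fs F (map (gp_term \<alpha> (u # v # w # R) ys) [0, 1, 2]) +
      fs F (map (gp_term \<alpha> (u # v # w # R) ys) [3..<length (u # v # w # R)])"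
    by (simp only: map_append fs_append)
  moreover have "size (fs F (map (gp_term \<alpha> (u # v # w # R) ys) [0, 1, 2])) = 3"
    using nz[of 0] nz[of 1] nz[of 2] by (simp add: fs_def)
  ultimately have "3 \<le> size (fs F ?T)" by simp
  moreover have "set_mset (fs F ?T) \<subseteq> carr - {\<zero>}"
    using gp_term_car[OF shape] by (auto simp: fs_def simp del: upt_Suc)
  ultimately show ?thesis using deg unfolding degenerate_def gp_null_def by blast
qed

lemma perm_front: "a \<in> set xs \<Longrightarrow> mset (a # remove1 a xs) = mset xs"
  by simp

text \<open>The set \<open>live\<close> collects the entries with nonzero terms. If exactly
  \<open>u\<close> and \<open>v\<close> are live, the aim is
  \<open>?p \<odot> ?y = ?p' \<odot> ?y'\<close>. The shorter relation gives
  \<open>?p \<odot> ?z = ?p' \<odot> ?t\<close> and the three-term relation gives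
  \<open>?t \<odot> ?y = ?z \<odot> ?y'\<close>; combining them eliminates \<open>?z\<close>, and
  \<open>?t\<close> cancels.\<close>

lemma degenerate_gp_step:
  assumes deg: "degenerate F" and all: "gp_all d"
    and shape: "gp_shape \<alpha> xs ys (Suc d)" and dist: "distinct (\<alpha> @ xs @ ys)"
  shows "gp_null \<alpha> xs ys"
proof -
  define A where "A = set \<alpha> \<union> set xs"
  define B where "B = set \<alpha> \<union> set ys"
  define live where "live a \<longleftrightarrow> a \<in> set xs \<and> A - {a} \<in> \<B> \<and> insert a B \<in> \<B>" for a
  have AB: "A - B = set xs" "B - A = set ys" "A \<inter> B = set \<alpha>" "finite A" "finite B"
    using dist by (auto simp: A_def B_def)
  have dists: "distinct (\<alpha> @ xs)" "distinct (\<alpha> @ ys)" using dist by auto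
  have term_zero: "gp_term \<alpha> xs' ys k = \<zero> \<longleftrightarrow> \<not> live (xs' ! k)"
    if xs': "mset xs' = mset xs" and k: "k < length xs'" for xs' k
  proof -
    have set: "set xs' = set xs" and len: "length xs' = length xs" using xs' by (metis mset_eq_setD, metis mset_eq_length)
    have "distinct xs'" using dist xs' by (metis distinct_append mset_eq_imp_distinct_iff)
    then have d': "distinct (\<alpha> @ xs')" using dist set by auto
    have shape': "gp_shape \<alpha> xs' ys (Suc d)" using shape set len by (simp add: gp_shape_def)
    have "xs' ! k \<in> set xs" using k set nth_mem by blast
    moreover from this have "xs' ! k \<notin> B" using AB by blast
    ultimately show ?thesis
      using gp_left_eq_zero[OF shape' d' k] gp_right_eq_zero[OF shape' dists(2) k] gp_factor_car[OF shape' k]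
      by (auto simp: gp_term_def live_def A_def B_def set)
  qed
  \<comment> \<open>Exchanging \<open>a\<close> out of \<open>insert a B\<close> against
    \<open>A - {a}\<close> returns the bases \<open>insert b B\<close> and \<open>A - {b}\<close>,
    so a single nonzero term cannot occur.\<close>
  have live_other: "\<exists>b. b \<noteq> a \<and> live b" if "live a" for a
  proof -
    have a: "a \<in> A" "a \<notin> B" and bs: "A - {a} \<in> \<B>" "insert a B \<in> \<B>" using that AB by (auto simp: live_def)
    obtain b where b: "b \<in> (A - {a}) - insert a B" "insert b (insert a B - {a}) \<in> \<B>" "insert a (A - {a} - {b}) \<in> \<B>"
      using exchange[OF bs(2,1), of a] by blast
    have "insert a (A - {a} - {b}) = A - {b}" "insert a B - {a} = B" using a b by auto
    then have "live b" using b AB by (auto simp: live_def)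
    then show ?thesis using b by blast
  qed
  consider "\<forall>a. \<not> live a" | u v w where "live u" "live v" "live w" "distinct [u, v, w]"
    | u v where "live u" "live v" "u \<noteq> v" "\<forall>w. live w \<longrightarrow> w = u \<or> w = v"
    using live_other by (metis distinct_length_2_or_more distinct_singleton)
  then show ?thesis
  proof cases
    case 1
    then show ?thesis using term_zero[OF refl] by (intro gp_null_zero) blast
  next
    case (2 u v w)
    define R where "R = remove1 w (remove1 v (remove1 u xs))"
    have mem: "u \<in> set xs" "v \<in> set (remove1 u xs)" "w \<in> set (remove1 v (remove1 u xs))"
      using 2 by (auto simp: live_def)
    have perm: "mset (u # v # w # R) = mset xs"
      using perm_front[OF mem(1)] perm_front[OF mem(2)] perm_front[OF mem(3)] unfolding R_def by (metis mset.simps(2))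
    have shape': "gp_shape \<alpha> (u # v # w # R) ys (Suc d)"
      using shape mset_eq_setD[OF perm] mset_eq_length[OF perm] by (simp add: gp_shape_def)
    have "gp_term \<alpha> (u # v # w # R) ys k \<noteq> \<zero>" if "k < 3" for k
    proof -
      have "live ((u # v # w # R) ! k)" using that 2 by (auto simp: less_Suc_eq numeral_3_eq_3)
      then show ?thesis using term_zero[OF perm, of k] that by simp
    qed
    from gp_null_perm_left[OF perm shape' gp_null_three_nonzero[OF deg shape' this]] show ?thesis .
  next
    case (3 u v)
    obtain j Q where ys: "ys = j # Q" using shape by (auto simp: gp_shape_def length_Suc_conv)
    define \<Gamma> where "\<Gamma> = set \<alpha> \<union> set Q"
    have B: "B = insert j \<Gamma>" "j \<notin> \<Gamma>" "j \<notin> A" using dist AB(2) by (auto simp: B_def \<Gamma>_def ys)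
    have uv: "u \<in> A" "v \<in> A" "u \<notin> B" "v \<notin> B" "A - {u} \<in> \<B>" "A - {v} \<in> \<B>" "insert u B \<in> \<B>" "insert v B \<in> \<B>"
      using 3 AB(1) by (auto simp: live_def)
    have xs_iff: "k \<in> set xs \<longleftrightarrow> k \<in> A \<and> k \<notin> B" for k using AB by blast
    have dead: "k \<in> set xs \<Longrightarrow> k \<noteq> u \<Longrightarrow> k \<noteq> v \<Longrightarrow> A - {k} \<in> \<B> \<Longrightarrow> insert k B \<notin> \<B>" for k
      using 3 by (auto simp: live_def)
    \<comment> \<open>The fourth condition makes \<open>?z\<close> nonzero. The fifth removes the
      third term of the three-term relation, and the last is what \<open>no_third\<close> needs to
      clear the shorter one. If \<open>A - {w}\<close> is a basis for some admissible
      \<open>w\<close>, then \<open>insert w B\<close> is not one because \<open>w\<close> is not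
      live, and both conditions hold. Otherwise their second alternatives hold for every
      \<open>w\<close>.\<close>
    obtain w where w: "w \<in> set xs" "w \<noteq> u" "w \<noteq> v" "insert w (insert u \<Gamma>) \<in> \<B>"
      "insert w B \<notin> \<B> \<or> insert v (insert u \<Gamma>) \<notin> \<B>"
      "\<And>k. k \<in> set xs \<Longrightarrow> k \<noteq> u \<Longrightarrow> k \<noteq> v \<Longrightarrow> A - {k} \<in> \<B> \<Longrightarrow> insert w B \<notin> \<B> \<or> insert k (insert u \<Gamma>) \<notin> \<B>"
    proof (cases "\<exists>w\<in>set xs. w \<noteq> u \<and> w \<noteq> v \<and> A - {w} \<in> \<B> \<and> insert w (insert u \<Gamma>) \<in> \<B>")
      case True
      then show ?thesis using that dead by metis
    next
      case False
      have no: "insert v (insert u \<Gamma>) \<notin> \<B>"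
      proof
        assume "insert v (insert u \<Gamma>) \<in> \<B>"
        \<comment> \<open>Exchanging \<open>v\<close> would produce a \<open>k\<close> of exactly
          the kind excluded by \<open>False\<close>.\<close>
        from exchange[OF this uv(6), of v] obtain k where
          k: "k \<in> (A - {v}) - insert v (insert u \<Gamma>)" "insert k (insert v (insert u \<Gamma>) - {v}) \<in> \<B>" "insert v (A - {v} - {k}) \<in> \<B>"
          by blast
        have "insert v (insert u \<Gamma>) - {v} = insert u \<Gamma>" "insert v (A - {v} - {k}) = A - {k}" using uv k 3 B by auto
        then show False using k False xs_iff[of k] B by auto
      qed
      from exchange[OF uv(7,5), of j] B uv obtain k where
        k: "k \<in> (A - {u}) - insert u B" "insert k (insert u B - {j}) \<in> \<B>" by blast
      have "insert u B - {j} = insert u \<Gamma>" using B uv by auto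
      then show ?thesis using that[of k] k no False xs_iff B by auto
    qed
    have wB: "w \<notin> B" "w \<in> A" using w xs_iff by auto
    have no_third: "insert k (insert w \<Gamma>) \<notin> \<B>" if k: "k \<in> set xs" "k \<noteq> u" "k \<noteq> v" "k \<noteq> w" "A - {k} \<in> \<B>" for k
    proof
      assume kw: "insert k (insert w \<Gamma>) \<in> \<B>"
      have kB: "k \<notin> B" using k xs_iff by auto
      \<comment> \<open>Only \<open>j\<close> and \<open>u\<close> can come in for \<open>w\<close>:
        the former would make \<open>k\<close> live, the latter contradicts the choice of
        \<open>w\<close>.\<close>
      from exchange[OF kw uv(7), of w] obtain l where
        l: "l \<in> insert u B - insert k (insert w \<Gamma>)" "insert l (insert k (insert w \<Gamma>) - {w}) \<in> \<B>" "insert w (insert u B - {l}) \<in> \<B>"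
        using B uv wB w by auto
      have "l = j \<or> l = u" using l B by auto
      then show False
      proof
        assume "l = j"
        then have "insert k B \<in> \<B>" using l(2) B k kB wB by (auto simp: insert_Diff_if insert_commute)
        with dead k show False by blast
      next
        assume "l = u"
        then have "insert k (insert u \<Gamma>) \<in> \<B>" "insert w B \<in> \<B>"
          using l(2,3) B k kB wB uv by (auto simp: insert_Diff_if insert_commute)
        with w(6)[OF k(1-3,5)] show False by blast
      qed
    qed
    define R where "R = remove1 w (remove1 v (remove1 u xs))"
    have mem: "u \<in> set xs" "v \<in> set (remove1 u xs)" "w \<in> set (remove1 v (remove1 u xs))"
      using 3 w by (auto simp: live_def)
    have perm: "mset (u # v # w # R) = mset xs"
      using perm_front[OF mem(1)] perm_front[OF mem(2)] perm_front[OF mem(3)] unfolding R_def by (metis mset.simps(2))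
    have set: "set xs = insert u (insert v (insert w (set R)))" using mset_eq_setD[OF perm] by auto
    have shape': "gp_shape \<alpha> (u # v # w # R) ys (Suc d)"
      using shape set mset_eq_length[OF perm] by (simp add: gp_shape_def)
    have dist': "distinct (\<alpha> @ u # v # w # R)" "distinct (u # v # w # R)"
    proof -
      show "distinct (u # v # w # R)" using dist perm by (metis distinct_append mset_eq_imp_distinct_iff)
      then show "distinct (\<alpha> @ u # v # w # R)" using dist set by auto
    qed
    have shape1: "gp_shape (\<alpha> @ [w]) (u # v # R) Q d" and shape2: "gp_shape (\<alpha> @ Q) [u, v, w] [j] 1"
      using shape' by (auto simp: gp_shape_def ys)
    have bounds: "set \<alpha> \<union> set Q \<union> set R \<union> {u, v, w, j} \<subseteq> {..<m}" and
      lens: "length \<alpha> + length R + 2 = q" "length \<alpha> + length Q + 2 = q"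
      using shape' by (auto simp: gp_shape_def ys)
    have wQ: "w \<notin> set Q" "u \<notin> set Q" "v \<notin> set Q" using wB uv by (auto simp: B_def ys)
    have A: "A = set \<alpha> \<union> {u, v, w} \<union> set R" using set by (auto simp: A_def)
    let ?p = "\<phi> (\<alpha> @ v # w # R)" and ?p' = "\<phi> (\<alpha> @ u # w # R)"
    let ?y = "\<phi> (\<alpha> @ u # j # Q)" and ?y' = "\<phi> (\<alpha> @ v # j # Q)"
    let ?z = "\<phi> (\<alpha> @ w # u # Q)" and ?t = "\<phi> (\<alpha> @ w # v # Q)"
    have car: "?p \<in> carr" "?p' \<in> carr" "?y \<in> carr" "?y' \<in> carr" "?z \<in> carr" "?t \<in> carr"
      using bounds lens by auto
    have "gp_null (\<alpha> @ [w]) (u # v # R) Q" using all shape1 by (simp add: gp_all_def)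
    then have "\<phi> ((\<alpha> @ [w]) @ v # R) \<odot> ?z = \<phi> ((\<alpha> @ [w]) @ u # R) \<odot> ?t"
    proof (subst (asm) gp_null_two_terms[OF shape1])
      show "distinct ((\<alpha> @ [w]) @ u # v # R)" "distinct ((\<alpha> @ [w]) @ Q)"
        using dist dist' wQ w(1) by (auto simp: ys)
      fix k assume k: "k \<in> set R"
      then have "k \<in> set xs" "k \<noteq> u" "k \<noteq> v" "k \<noteq> w" using set dist'(2) by auto
      with no_third[of k] have "A - {k} \<notin> \<B> \<or> insert k (insert w \<Gamma>) \<notin> \<B>" by blast
      moreover have "A = set (\<alpha> @ [w]) \<union> set (u # v # R)" "insert w \<Gamma> = set (\<alpha> @ [w]) \<union> set Q" by (auto simp: A \<Gamma>_def)
      ultimately show "set (\<alpha> @ [w]) \<union> set (u # v # R) - {k} \<notin> \<B> \<or> insert k (set (\<alpha> @ [w]) \<union> set Q) \<notin> \<B>" by simp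
    qed simp
    moreover have "?p = neg F (\<phi> (\<alpha> @ w # v # R))" "?p' = neg F (\<phi> (\<alpha> @ w # u # R))"
      using bounds lens by (auto intro!: phi_swap)
    moreover have "\<phi> (\<alpha> @ w # v # R) \<in> carr" "\<phi> (\<alpha> @ w # u # R) \<in> carr" using bounds lens by auto
    ultimately have eq1: "?p \<odot> ?z = ?p' \<odot> ?t" using car by simp
    have "gp_null (\<alpha> @ Q) [u, v, w] [j]" using gp_all_1 shape2 by (simp add: gp_all_def)
    then have "\<phi> ((\<alpha> @ Q) @ [v, w]) \<odot> \<phi> ((\<alpha> @ Q) @ [u, j]) = \<phi> ((\<alpha> @ Q) @ [u, w]) \<odot> \<phi> ((\<alpha> @ Q) @ [v, j])"
    proof (subst (asm) gp_null_two_terms[OF shape2])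
      show "distinct ((\<alpha> @ Q) @ [u, v, w])" "distinct ((\<alpha> @ Q) @ [j])"
        using dist dist' wQ by (auto simp: ys)
      fix k assume "k \<in> set [w]"
      moreover have "set (\<alpha> @ Q) \<union> set [u, v, w] - {w} = insert v (insert u \<Gamma>)" "insert w (set (\<alpha> @ Q) \<union> set [j]) = insert w B"
        using wQ dist' B by (auto simp: \<Gamma>_def)
      ultimately show "set (\<alpha> @ Q) \<union> set [u, v, w] - {k} \<notin> \<B> \<or> insert k (set (\<alpha> @ Q) \<union> set [j]) \<notin> \<B>"
        using w(5) by auto
    qed simp
    \<comment> \<open>Two entries pass \<open>Q\<close>, so the sign is even; this brings the
      factors of the three-term relation into the form used for the shorter one.\<close>
    moreover have shift: "\<phi> ((\<alpha> @ Q) @ [e, f]) = sgnp F (length Q + length Q) (\<phi> (\<alpha> @ e # f # Q))"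
      if "e < m" "f < m" for e f
      using phi_move[of "\<alpha>" e Q "[f]"] phi_move[of "\<alpha> @ [e]" f Q "[]"] that bounds lens by (simp add: sgnp_add)
    moreover have "\<phi> (\<alpha> @ e # w # Q) = neg F (\<phi> (\<alpha> @ w # e # Q))" if "e < m" for e
      using that bounds lens by (intro phi_swap) auto
    ultimately have eq2: "?t \<odot> ?y = ?z \<odot> ?y'"
      using bounds car by (simp add: sgnp_add neg_sgnp)
    have "?z \<noteq> \<zero>" using w(2,4) dist dist' wQ bounds lens
      by (subst phi_eq_zero) (auto simp: \<Gamma>_def ys insert_commute)
    moreover have "?p \<noteq> \<zero>"
    proof -
      have "set (\<alpha> @ v # w # R) = A - {u}" using dist' by (auto simp: A)
      then show ?thesis using uv dist' bounds lens by (subst phi_eq_zero) auto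
    qed
    ultimately have t: "?t \<noteq> \<zero>" using eq1 car by (metis mult_eq_zero mult_zero)
    have "?t \<odot> (?p \<odot> ?y) = ?p \<odot> (?t \<odot> ?y)" by (rule mult_left_comm) (fact car)+
    also have "\<dots> = ?p \<odot> ?z \<odot> ?y'" using car by (simp only: eq2 mult_assoc)
    also have "\<dots> = ?p' \<odot> (?t \<odot> ?y')" using car by (simp only: eq1 mult_assoc mult_car)
    also have "\<dots> = ?t \<odot> (?p' \<odot> ?y')" by (rule mult_left_comm) (fact car)+
    finally have "?p \<odot> ?y = ?p' \<odot> ?y'" using car t by - (rule mult_cancel_left[of ?t], simp_all)
    then have "gp_null \<alpha> (u # v # w # R) ys"
    proof (subst gp_null_two_terms[OF shape' dist'(1) dists(2)])
      fix k assume k: "k \<in> set (w # R)"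
      then have "k \<in> set xs" "k \<noteq> u" "k \<noteq> v" using set dist'(2) by auto
      with dead[of k] have "A - {k} \<notin> \<B> \<or> insert k B \<notin> \<B>" by blast
      moreover have "A = set \<alpha> \<union> set (u # v # w # R)" by (auto simp: A)
      ultimately show "set \<alpha> \<union> set (u # v # w # R) - {k} \<notin> \<B> \<or> insert k (set \<alpha> \<union> set ys) \<notin> \<B>"
        by (simp add: B_def)
    qed (simp add: ys)
    from gp_null_perm_left[OF perm shape' this] show ?thesis .
  qed
qed

lemma degenerate_gp_all: "degenerate F \<Longrightarrow> gp_all d"
  by (rule gp_all_induct, rule degenerate_gp_step)

end

section \<open>The Krasner and tropical hyperfields\<close>

lemma mprod_simps [simp]:
  "mprod F {#} S = {#}" "mprod F (add_mset t T) S = image_mset (tmul F t) S + mprod F T S"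
  by (simp_all add: mprod_def)

lemma is_tract_krasner: "is_tract krasner"
proof -
  \<comment> \<open>Sizes multiply, and a product of natural numbers is 1 only if both factors are;
    hence a null factor keeps the product null.\<close>
  have mprod: "set_mset (mprod krasner T S) \<subseteq> {True} \<and> size (mprod krasner T S) = size T * size S"
    if "set_mset S \<subseteq> {True}" "set_mset T \<subseteq> {True}" for S T
    using that by (induction T) (auto simp: krasner_def)
  have neg: "\<exists>!b. b \<in> UNIV \<and> fs krasner [a, b] \<in> tnull krasner" for a
    by (rule ex1I[of _ a]; cases a) (auto simp: fs_def krasner_def split: if_splits)
  show ?thesis
    unfolding is_tract_def
  proof (intro conjI)
    show "\<forall>S\<in>tnull krasner. \<forall>T. set_mset T \<subseteq> tcar krasner - {tzero krasner} \<longrightarrow> mprod krasner T S \<in> tnull krasner"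
    proof (intro ballI allI impI)
      fix S T assume "S \<in> tnull krasner" and "set_mset T \<subseteq> tcar krasner - {tzero krasner}"
      then have "set_mset S \<subseteq> {True}" "size S \<noteq> 1" "set_mset T \<subseteq> {True}" by (auto simp: krasner_def)
      with mprod show "mprod krasner T S \<in> tnull krasner" by (auto simp: krasner_def)
    qed
    show "\<forall>a\<in>tcar krasner. \<exists>!b. b \<in> tcar krasner \<and> fs krasner [a, b] \<in> tnull krasner"
      using neg by (simp add: krasner_def)
  qed (auto simp: krasner_def)
qed

lemma degenerate_krasner: "degenerate krasner"
  by (auto simp: degenerate_def krasner_def)

section \<open>The tropical tract and valuated matroids\<close>

lemma tropical_sel [simp]:
  "tcar tropical = {x. 0 \<le> x}" "tzero tropical = 0" "tone tropical = 1" "tmul tropical = (*)"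
  by (simp_all add: tropical_def)

text \<open>Unlike the condition on the maximum, this one is visibly stable under sums.\<close>
lemma tropical_null_iff:
  "S \<in> tnull tropical \<longleftrightarrow> (\<forall>x\<in>#S. 0 < x \<and> 2 \<le> size {#y \<in># S. x \<le> y#})"
proof (cases "S = {#}")
  case False
  have "(2 \<le> count S (Max_mset S)) \<longleftrightarrow> (\<forall>x\<in>#S. 2 \<le> size {#y \<in># S. x \<le> y#})"
  proof
    assume 2: "2 \<le> count S (Max_mset S)"
    show "\<forall>x\<in>#S. 2 \<le> size {#y \<in># S. x \<le> y#}"
    proof
      fix x assume "x \<in># S"
      then have "count S (Max_mset S) = count {#y \<in># S. x \<le> y#} (Max_mset S)" by simp
      also have "\<dots> \<le> size {#y \<in># S. x \<le> y#}" by (rule count_le_size)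
      finally show "2 \<le> size {#y \<in># S. x \<le> y#}" using 2 by simp
    qed
  next
    assume all: "\<forall>x\<in>#S. 2 \<le> size {#y \<in># S. x \<le> y#}"
    have "Max_mset S \<in># S" using False by simp
    moreover have "{#y \<in># S. Max_mset S \<le> y#} = {#y \<in># S. y = Max_mset S#}"
      by (rule filter_mset_cong) (auto intro: antisym)
    ultimately show "2 \<le> count S (Max_mset S)" using all by (auto simp: filter_eq_replicate_mset)
  qed
  then show ?thesis using False by (auto simp: tropical_def)
qed (simp add: tropical_def)

lemma tropical_null_pair: "0 \<le> a \<Longrightarrow> 0 \<le> b \<Longrightarrow> fs tropical [a, b] \<in> tnull tropical \<longleftrightarrow> a = b"
  by (auto simp: fs_def tropical_null_iff)

lemma is_tract_tropical: "is_tract tropical"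
  unfolding is_tract_def
proof (intro conjI)
  have add: "S + T \<in> tnull tropical" if "S \<in> tnull tropical" "T \<in> tnull tropical" for S T
    using that unfolding tropical_null_iff by (auto intro: trans_le_add1 trans_le_add2)
  then show "\<forall>S\<in>tnull tropical. \<forall>T\<in>tnull tropical. S + T \<in> tnull tropical" by blast
  \<comment> \<open>Multiplication by a positive number preserves the order, hence the number of
    terms above each term.\<close>
  have scale: "image_mset ((*) t) S \<in> tnull tropical" if "S \<in> tnull tropical" "0 < t" for S t
    using that unfolding tropical_null_iff
    by (auto simp: filter_mset_image_mset mult_le_cancel_left_pos)
  show "\<forall>S\<in>tnull tropical. \<forall>T. set_mset T \<subseteq> tcar tropical - {tzero tropical} \<longrightarrow> mprod tropical T S \<in> tnull tropical"
  proof (intro ballI allI impI)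
    fix S T assume "S \<in> tnull tropical" and "set_mset T \<subseteq> tcar tropical - {tzero tropical}"
    then show "mprod tropical T S \<in> tnull tropical"
    proof (induction T)
      case (add t T)
      then have "0 < t" by auto
      with add show ?case using scale \<open>\<And>S T. S \<in> tnull tropical \<Longrightarrow> T \<in> tnull tropical \<Longrightarrow> S + T \<in> tnull tropical\<close>
        by auto
    qed (simp add: tropical_null_iff)
  qed
  show "\<forall>a\<in>tcar tropical. \<exists>!b. b \<in> tcar tropical \<and> fs tropical [a, b] \<in> tnull tropical"
    using tropical_null_pair by auto
  show "\<forall>a\<in>tcar tropical - {tzero tropical}. \<exists>b\<in>tcar tropical - {tzero tropical}. tmul tropical a b = tone tropical"
  proof
    fix a :: real assume "a \<in> tcar tropical - {tzero tropical}"
    then show "\<exists>b\<in>tcar tropical - {tzero tropical}. tmul tropical a b = tone tropical"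
      by (intro bexI[of _ "inverse a"]) auto
  qed
qed (auto simp: tropical_null_iff intro: less_imp_le)

lemma neg_tropical: "0 \<le> a \<Longrightarrow> neg tropical a = a"
  unfolding neg_def by (rule the_equality) (auto simp: tropical_null_pair)

lemma sgnp_tropical: "0 \<le> a \<Longrightarrow> sgnp tropical k a = a"
  unfolding sgnp_def by (induction k) (auto simp: neg_tropical)

text \<open>Dress--Wenzel/Murota: the local exchange property of a valuated matroid implies the
  global one.  Choosing \<open>w\<close> to maximise \<open>g (A - {w}) * g (insert w (insert u \<Gamma>))\<close> turns a violation
  for \<open>(A, B)\<close> into one for the closer pair \<open>(A, insert w \<Gamma>)\<close>, where \<open>\<Gamma> = B - {j}\<close>.\<close>
lemma valuated_exchange:
  fixes g :: "nat set \<Rightarrow> real"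
  assumes nonneg: "\<And>S. 0 \<le> g S"
    and exch: "\<And>S T i. finite S \<Longrightarrow> finite T \<Longrightarrow> card S = q \<Longrightarrow> card T = q \<Longrightarrow> 0 < g S \<Longrightarrow> 0 < g T \<Longrightarrow> i \<in> S - T \<Longrightarrow>
      \<exists>j\<in>T - S. 0 < g (insert j (S - {i}))"
    and local: "\<And>\<Gamma> a b c d. finite \<Gamma> \<Longrightarrow> card \<Gamma> + 2 = q \<Longrightarrow> \<Gamma> \<inter> {a, b, c, d} = {} \<Longrightarrow> distinct [a, b, c, d] \<Longrightarrow>
      g (insert a (insert b \<Gamma>)) * g (insert c (insert d \<Gamma>)) \<le>
      max (g (insert a (insert c \<Gamma>)) * g (insert b (insert d \<Gamma>))) (g (insert a (insert d \<Gamma>)) * g (insert b (insert c \<Gamma>)))"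
    and "finite A" "card A = q + 1"
  shows "finite B \<Longrightarrow> card B + 1 = q \<Longrightarrow> u \<in> A - B \<Longrightarrow> 0 < g (A - {u}) * g (insert u B) \<Longrightarrow>
    \<exists>v\<in>A - B - {u}. g (A - {u}) * g (insert u B) \<le> g (A - {v}) * g (insert v B)"
proof (induction "card (B - A)" arbitrary: B rule: less_induct)
  case less
  note A = \<open>finite A\<close> \<open>card A = q + 1\<close>
  show ?case
  proof (cases "B \<subseteq> A")
    \<comment> \<open>Here \<open>A - B\<close> consists of \<open>u\<close> and one further element
      \<open>v\<close>, and the two products coincide up to order.\<close>
    case True
    then have "card (A - B - {u}) = 1"
      using A less.prems by (simp add: card_Diff_subset)
    then obtain v where v: "A - B - {u} = {v}" by (auto simp: card_1_singleton_iff)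
    then have "A - {u} = insert v B" "A - {v} = insert u B" using True less.prems by auto
    with v show ?thesis by (auto simp: mult.commute)
  next
    case False
    then obtain j where j: "j \<in> B" "j \<notin> A" by blast
    define \<Gamma> where "\<Gamma> = B - {j}"
    have B: "B = insert j \<Gamma>" "j \<notin> \<Gamma>" "finite \<Gamma>" "card \<Gamma> + 2 = q"
      using j less.prems card_Suc_Diff1[of B j] by (auto simp: \<Gamma>_def)
    define V where "V = A - B - {u}"
    have V: "finite V" using A by (simp add: V_def)
    define x where "x v = g (A - {v})" for v
    define y where "y v = g (insert v B)" for v
    define z where "z v = g (insert v (insert u \<Gamma>))" for v
    have nn: "0 \<le> x v" "0 \<le> y v" "0 \<le> z v" for v by (simp_all add: x_def y_def z_def nonneg)
    have u: "u \<in> A" "u \<notin> B" "0 < x u * y u" using less.prems by (auto simp: x_def y_def)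
    then have pos: "0 < x u" "0 < y u" using nn[of u] by (auto simp: zero_less_mult_iff)
    obtain w0 where w0: "w0 \<in> V" "0 < z w0"
    proof -
      have "card (insert u B) = q" "card (A - {u}) = q" using u A less.prems by auto
      then obtain k where k: "k \<in> A - {u} - insert u B" "0 < g (insert k (insert u B - {j}))"
        using exch[of "insert u B" "A - {u}" j] u A less.prems j pos by (auto simp: x_def y_def)
      have "insert u B - {j} = insert u \<Gamma>" using B u by auto
      with k that[of k] show ?thesis by (auto simp: V_def z_def)
    qed
    obtain w where w: "w \<in> V" "0 < z w" "\<And>v. v \<in> V \<Longrightarrow> x v * z v \<le> x w * z w"
    proof -
      obtain w1 where w1: "w1 \<in> V" "\<And>v. v \<in> V \<Longrightarrow> x v * z v \<le> x w1 * z w1"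
      proof -
        let ?f = "\<lambda>v. x v * z v"
        have "Max (?f ` V) \<in> ?f ` V" using V w0(1) by (intro Max_in) auto
        then obtain w1 where "w1 \<in> V" "?f w1 = Max (?f ` V)" by auto
        then show ?thesis using that V by auto
      qed
      show ?thesis
      \<comment> \<open>The argument divides by \<open>z w\<close> in effect, so \<open>z w\<close>
        must be positive. If the maximum is attained where \<open>z\<close> is zero, it is zero, and
        \<open>w0\<close> attains it too.\<close>
      proof (cases "z w1 = 0")
        case True
        have "x v * z v \<le> x w0 * z w0" if "v \<in> V" for v
          using w1(2)[OF that] True mult_nonneg_nonneg[OF nn(1,3), of w0 w0] by simp
        then show ?thesis using that w0 by blast
      next
        case False
        then show ?thesis using that w1 nn(3)[of w1] by force
      qed
    qed
    have wV: "w \<in> A" "w \<notin> B" "w \<noteq> u" "w \<noteq> j" using w(1) j by (auto simp: V_def)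
    show ?thesis
    proof (rule ccontr)
      assume "\<not> ?thesis"
      then have less_u: "x v * y v < x u * y u" if "v \<in> V" for v
        using that unfolding V_def x_def y_def by (meson not_le)
      \<comment> \<open>Replacing \<open>j\<close>, which lies outside \<open>A\<close>, by
        \<open>w\<close>, which lies inside, brings the pair closer.\<close>
      have "card (insert w \<Gamma> - A) < card (B - A)"
        using j wV B less.prems(1) by (intro psubset_card_mono) auto
      moreover have "0 < g (A - {u}) * g (insert u (insert w \<Gamma>))"
        using pos w(2) by (simp add: x_def z_def insert_commute)
      ultimately obtain v where v: "v \<in> A - insert w \<Gamma> - {u}"
        "g (A - {u}) * g (insert u (insert w \<Gamma>)) \<le> g (A - {v}) * g (insert v (insert w \<Gamma>))"
        using less.hyps[of "insert w \<Gamma>"] B wV u by auto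
      let ?s = "g (insert w (insert v \<Gamma>))"
      have vV: "v \<in> V" "v \<noteq> w" "v \<noteq> j" "v \<noteq> u" using v(1) j B(1) by (auto simp: V_def)
      have ge: "x u * z w \<le> x v * ?s" using v(2) by (simp add: x_def z_def insert_commute)
      \<comment> \<open>Local exchange with common part \<open>\<Gamma>\<close> and pairs
        \<open>w, v\<close> and \<open>j, u\<close>. After multiplication by \<open>x v\<close>, the
        choice of \<open>w\<close> bounds the first alternative and the assumed violation the
        second.\<close>
      have "?s * g (insert j (insert u \<Gamma>)) \<le>
        max (g (insert w (insert j \<Gamma>)) * g (insert v (insert u \<Gamma>))) (g (insert w (insert u \<Gamma>)) * g (insert v (insert j \<Gamma>)))"
        using B wV vV u j v(1) by (intro local) auto
      then have "?s * y u \<le> max (y w * z v) (z w * y v)" by (simp add: y_def z_def B(1) insert_commute)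
      then have "x v * (?s * y u) \<le> x v * max (y w * z v) (z w * y v)" using nn by (intro mult_left_mono)
      also have "\<dots> = max (y w * (x v * z v)) (z w * (x v * y v))"
        using nn by (simp add: max_mult_distrib_left mult_ac)
      also have "\<dots> < z w * (x u * y u)"
      proof -
        have "y w * (x v * z v) \<le> y w * (x w * z w)" using w(3) vV(1) nn by (intro mult_left_mono)
        also have "\<dots> = z w * (x w * y w)" by (simp add: mult_ac)
        also have "\<dots> < z w * (x u * y u)" using w less_u by (intro mult_strict_left_mono)
        finally have "y w * (x v * z v) < z w * (x u * y u)" .
        moreover have "z w * (x v * y v) < z w * (x u * y u)" using w(2) less_u vV by (intro mult_strict_left_mono)
        ultimately show ?thesis by simp
      qed
      finally have "x v * (?s * y u) < x u * z w * y u" by (simp add: mult_ac)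
      moreover have "x u * z w * y u \<le> x v * ?s * y u" using ge pos(2) by (intro mult_right_mono) auto
      ultimately show False by (simp add: mult_ac)
    qed
  qed
qed

text \<open>Phrased with positions, since the largest value may be attained twice by equal entries
  of the list.\<close>

lemma tropical_null_sumI:
  assumes "\<And>x. x \<in> set xs \<Longrightarrow> 0 \<le> x"
    and "\<And>k. k < length xs \<Longrightarrow> 0 < xs ! k \<Longrightarrow> \<exists>l<length xs. l \<noteq> k \<and> xs ! k \<le> xs ! l"
  shows "fs tropical xs \<in> tnull tropical"
  unfolding tropical_null_iff
proof
  fix x assume "x \<in># fs tropical xs"
  then have x: "x \<in> set xs" "0 < x" using assms(1) by (force simp: fs_def)+
  then obtain k where k: "k < length xs" "xs ! k = x" by (auto simp: in_set_conv_nth)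
  then obtain l where l: "l < length xs" "l \<noteq> k" "x \<le> xs ! l" using assms(2) x by blast
  have "{#y \<in># fs tropical xs. x \<le> y#} = filter_mset (\<lambda>y. x \<le> y) (mset xs)"
    using x by (auto simp: fs_eq_filter_mset filter_filter_mset intro!: filter_mset_cong)
  then have "size {#y \<in># fs tropical xs. x \<le> y#} = card {i. i < length xs \<and> x \<le> xs ! i}"
    by (metis length_filter_conv_card mset_filter size_mset)
  moreover have "card {k, l} \<le> card {i. i < length xs \<and> x \<le> xs ! i}"
    using k l by (intro card_mono) auto
  ultimately show "0 < x \<and> 2 \<le> size {#y \<in># fs tropical xs. x \<le> y#}" using l x by simp
qed

lemma tropical_null_triple:
  assumes "fs tropical [a, b, c] \<in> tnull tropical" "0 \<le> a" "0 \<le> b" "0 \<le> c"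
  shows "a \<le> max b c"
proof (rule ccontr)
  assume "\<not> ?thesis"
  then have "b < a" "c < a" by auto
  then have "{#y \<in># fs tropical [a, b, c]. a \<le> y#} = {#a#}" "a \<in># fs tropical [a, b, c]"
    using assms by (auto simp: fs_def)
  with assms(1) show False unfolding tropical_null_iff by fastforce
qed

text \<open>Negation is the identity, so \<open>\<phi>\<close> depends only on the set of its
  entries and becomes a valuated matroid \<open>g\<close>. Its global exchange property says that no
  positive term exceeds all the others.\<close>

lemma tropical_gp_all:
  assumes "weak_matroid_rep tropical m q \<phi> \<B>"
  shows "weak_matroid_rep.gp_all tropical m q \<phi> d"
proof -
  interpret weak_matroid_rep tropical m q \<phi> \<B> by fact
  have perm: "\<phi> xs = \<phi> ys" if "mset xs = mset ys" "set xs \<subseteq> {..<m}" "length xs = q" for xs ys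
  proof -
    have "set xs \<subseteq> {..<m} \<and> length xs = q \<and> \<phi> xs = \<phi> xs" using that by simp
    with that(1) have "set ys \<subseteq> {..<m} \<and> length ys = q \<and> \<phi> xs = \<phi> ys"
    proof (induction rule: mset_swap_induct)
      case (swap ps a b qs)
      then have "\<phi> (ps @ b # a # qs) = neg tropical (\<phi> (ps @ a # b # qs))" by (intro phi_swap) auto
      moreover have "0 \<le> \<phi> (ps @ a # b # qs)" using swap phi_car[of "ps @ a # b # qs"] by simp
      ultimately show ?case using swap by (auto simp: neg_tropical)
    qed
    then show ?thesis by simp
  qed
  define g where "g S = (if S \<subseteq> {..<m} \<and> card S = q then \<phi> (sorted_list_of_set S) else 0)" for S
  have phi_g: "\<phi> xs = g (set xs)" if "set xs \<subseteq> {..<m}" "length xs = q" "distinct xs" for xs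
  proof -
    have "mset xs = mset (sorted_list_of_set (set xs))"
      using that(3) by (metis List.finite_set distinct_sorted_list_of_set set_eq_iff_mset_eq_distinct set_sorted_list_of_set)
    with perm[of xs "sorted_list_of_set (set xs)"] that show ?thesis by (simp add: g_def distinct_card)
  qed
  have g_nonneg: "0 \<le> g S" for S
  proof (cases "S \<subseteq> {..<m} \<and> card S = q")
    case True
    then have "finite S" using finite_subset by blast
    with True phi_car[of "sorted_list_of_set S"] show ?thesis by (simp add: g_def)
  qed (auto simp: g_def)
  have g_pos: "0 < g S \<longleftrightarrow> S \<in> \<B>" for S
  proof (cases "S \<subseteq> {..<m} \<and> card S = q")
    case True
    then have "finite S" using finite_subset by blast
    with True phi_eq_zero[of "sorted_list_of_set S"] have "g S \<noteq> 0 \<longleftrightarrow> S \<in> \<B>" by (simp add: g_def)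
    with g_nonneg[of S] show ?thesis by linarith
  next
    case False
    then show ?thesis using bases[of S] by (auto simp: g_def)
  qed
  have exch: "\<exists>j\<in>T - S. 0 < g (insert j (S - {i}))" if "0 < g S" "0 < g T" "i \<in> S - T" for S T i
    using that exchange[of S T i] by (auto simp: g_pos)
  have local: "g (insert a (insert b \<Gamma>)) * g (insert c (insert d \<Gamma>)) \<le>
      max (g (insert a (insert c \<Gamma>)) * g (insert b (insert d \<Gamma>))) (g (insert a (insert d \<Gamma>)) * g (insert b (insert c \<Gamma>)))"
    if \<Gamma>: "finite \<Gamma>" "card \<Gamma> + 2 = q" "\<Gamma> \<inter> {a, b, c, d} = {}" and dist: "distinct [a, b, c, d]" for \<Gamma> a b c d
  proof (cases "\<Gamma> \<union> {a, b, c, d} \<subseteq> {..<m}")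
    case False
    then have "g (insert a (insert b \<Gamma>)) = 0 \<or> g (insert c (insert d \<Gamma>)) = 0" by (auto simp: g_def)
    moreover have "0 \<le> g S * g T" for S T by (simp add: g_nonneg)
    ultimately show ?thesis by (auto simp: le_max_iff_disj)
  next
    case True
    define \<alpha> where "\<alpha> = sorted_list_of_set \<Gamma>"
    have \<alpha>: "set \<alpha> = \<Gamma>" "distinct \<alpha>" "length \<alpha> + 2 = q" using \<Gamma> by (simp_all add: \<alpha>_def)
    \<comment> \<open>Putting \<open>c\<close> first makes the leading term the product to be
      bounded.\<close>
    have "gp_null \<alpha> [c, a, b] [d]"
      using gp_all_1 \<alpha> True by (auto simp: gp_all_def gp_shape_def)
    moreover have phi: "\<phi> (\<alpha> @ [k, l]) = g (insert k (insert l \<Gamma>))"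
      if "k \<in> {a, b, c, d}" "l \<in> {a, b, c, d}" "k \<noteq> l" for k l
    proof -
      have "distinct (\<alpha> @ [k, l])" "set (\<alpha> @ [k, l]) \<subseteq> {..<m}" "length (\<alpha> @ [k, l]) = q"
        using that \<alpha> \<Gamma> True by auto
      from phi_g[OF this(2,3,1)] show ?thesis using \<alpha> by (simp add: insert_commute Un_commute)
    qed
    ultimately have "fs tropical [g (insert a (insert b \<Gamma>)) * g (insert c (insert d \<Gamma>)),
        g (insert c (insert b \<Gamma>)) * g (insert a (insert d \<Gamma>)),
        g (insert c (insert a \<Gamma>)) * g (insert b (insert d \<Gamma>))] \<in> tnull tropical"
      using dist g_nonneg by (simp add: gp_null_def gp_term_def neg_tropical upt_rec numeral_2_eq_2)
    from tropical_null_triple[OF this] show ?thesis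
      by (simp add: g_nonneg insert_commute mult.commute max.commute)
  qed
  have "gp_null \<alpha> xs ys" if shape: "gp_shape \<alpha> xs ys d" and dist: "distinct (\<alpha> @ xs @ ys)" for \<alpha> xs ys d
  proof -
    define A where "A = set \<alpha> \<union> set xs"
    define B where "B = set \<alpha> \<union> set ys"
    have "card A = length (\<alpha> @ xs)" "card B = length (\<alpha> @ ys)"
      using dist distinct_card[of "\<alpha> @ xs"] distinct_card[of "\<alpha> @ ys"] by (auto simp: A_def B_def)
    then have AB: "finite A" "finite B" "card A = q + 1" "card B + 1 = q" "A - B = set xs"
      using shape dist by (auto simp: A_def B_def gp_shape_def)
    have factors: "\<phi> (\<alpha> @ rem k xs) = g (A - {xs ! k})" "\<phi> (\<alpha> @ xs ! k # ys) = g (insert (xs ! k) B)"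
      if k: "k < length xs" for k
    proof -
      have "xs ! k \<in> set xs" using k by simp
      moreover have "set (\<alpha> @ rem k xs) = A - {xs ! k}" "distinct (\<alpha> @ rem k xs)"
        using dist k \<open>xs ! k \<in> set xs\<close> set_rem_subset[of k xs] by (auto simp: A_def set_rem distinct_rem)
      moreover have "set (\<alpha> @ xs ! k # ys) = insert (xs ! k) B" "distinct (\<alpha> @ xs ! k # ys)"
        using dist \<open>xs ! k \<in> set xs\<close> by (auto simp: B_def)
      ultimately show "\<phi> (\<alpha> @ rem k xs) = g (A - {xs ! k})" "\<phi> (\<alpha> @ xs ! k # ys) = g (insert (xs ! k) B)"
        using phi_g[of "\<alpha> @ rem k xs"] phi_g[of "\<alpha> @ xs ! k # ys"] shape k
        by (auto simp: gp_shape_def subset_iff A_def B_def)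
    qed
    define h where "h a = g (A - {a}) * g (insert a B)" for a
    have "gp_term \<alpha> xs ys k = h (xs ! k)" if "k < length xs" for k
      using factors[OF that] g_nonneg by (simp add: gp_term_def h_def sgnp_tropical)
    then have "map (gp_term \<alpha> xs ys) [0..<length xs] = map h xs" by (intro nth_equalityI) simp_all
    moreover have "fs tropical (map h xs) \<in> tnull tropical"
    proof (rule tropical_null_sumI)
      fix k assume k: "k < length (map h xs)" "0 < map h xs ! k"
      then have "xs ! k \<in> A - B" using AB by simp
      moreover have "0 < g (A - {xs ! k}) * g (insert (xs ! k) B)" using k by (simp add: h_def)
      ultimately obtain v where v: "v \<in> A - B - {xs ! k}" "h (xs ! k) \<le> h v"
        using valuated_exchange[OF g_nonneg exch local AB(1,3,2,4)] unfolding h_def by blast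
      then obtain l where "l < length xs" "xs ! l = v" "l \<noteq> k" using AB(5) by (auto simp: in_set_conv_nth)
      with v k show "\<exists>l<length (map h xs). l \<noteq> k \<and> map h xs ! k \<le> map h xs ! l" by auto
    qed (auto simp: h_def g_nonneg)
    ultimately show ?thesis by (simp add: gp_null_def)
  qed
  then show ?thesis by (intro gp_all_induct)
qed

section \<open>Polarization\<close>

text \<open>Translation by the componentwise minimum preserves the exchange property. Entries of
  \<open>J\<close> are at most \<open>r\<close>, so the minimum is over a finite set and the
  truncated subtractions are exact.\<close>

lemma Jbar_exchange:
  assumes J: "m_convex n r J" and ab: "a \<in> Jbar J" "b \<in> Jbar J" "b i < a i"
  shows "\<exists>j. a j < b j \<and> a(i := a i - 1, j := a j + 1) \<in> Jbar J \<and> b(i := b i + 1, j := b j - 1) \<in> Jbar J"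
proof -
  let ?\<delta> = "dminus J"
  have "\<alpha> e \<le> r" if "\<alpha> \<in> J" for \<alpha> e
  proof -
    have "\<alpha> \<in> Delta r n" using J that unfolding m_convex_def by blast
    then show ?thesis using member_le_sum[of e "{..<n}" \<alpha>] by (cases "e < n") (auto simp: Delta_def)
  qed
  then have "finite ((\<lambda>\<alpha>. \<alpha> e) ` J)" for e by - (rule finite_subset[of _ "{..r}"], auto)
  then have \<delta>: "?\<delta> e \<le> \<alpha> e" if "\<alpha> \<in> J" for \<alpha> e
    unfolding dminus_def by (rule Min_le) (use that in blast)
  obtain \<alpha> \<beta> where \<alpha>: "\<alpha> \<in> J" "a = (\<lambda>e. \<alpha> e - ?\<delta> e)" and \<beta>: "\<beta> \<in> J" "b = (\<lambda>e. \<beta> e - ?\<delta> e)"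
    using ab by (auto simp: Jbar_def)
  have "\<beta> i < \<alpha> i" using ab(3) \<alpha>(2) \<beta>(2) \<delta>[OF \<alpha>(1), of i] \<delta>[OF \<beta>(1), of i] by auto
  then obtain j where j: "\<alpha> j < \<beta> j" "\<alpha>(i := \<alpha> i - 1, j := \<alpha> j + 1) \<in> J" "\<beta>(i := \<beta> i + 1, j := \<beta> j - 1) \<in> J"
    using J \<alpha>(1) \<beta>(1) unfolding m_convex_def by blast
  have "a(i := a i - 1, j := a j + 1) \<in> Jbar J"
    unfolding Jbar_def by (rule image_eqI[OF _ j(2)]) (use \<delta>[OF \<alpha>(1), of j] in \<open>auto simp: \<alpha>(2) fun_eq_iff\<close>)
  moreover have "b(i := b i + 1, j := b j - 1) \<in> Jbar J"
    unfolding Jbar_def by (rule image_eqI[OF _ j(3)]) (use \<delta>[OF \<beta>(1), of i] in \<open>auto simp: \<beta>(2) fun_eq_iff\<close>)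
  moreover have "a j < b j" using j(1) \<delta>[OF \<alpha>(1), of j] by (simp add: \<alpha>(2) \<beta>(2))
  ultimately show ?thesis by blast
qed

definition label_count :: "nat list \<Rightarrow> nat set \<Rightarrow> nat \<Rightarrow> nat" where
  "label_count ls S e = card {p \<in> S. ls ! p = e}"

lemma label_count_insert:
  "finite S \<Longrightarrow> j \<notin> S \<Longrightarrow> label_count ls (insert j S) e = label_count ls S e + of_bool (ls ! j = e)"
proof -
  assume "finite S" "j \<notin> S"
  moreover have "{p \<in> insert j S. ls ! p = e} = (if ls ! j = e then insert j {p \<in> S. ls ! p = e} else {p \<in> S. ls ! p = e})" by auto
  ultimately show ?thesis by (simp add: label_count_def)
qed

text \<open>The additive form avoids truncated subtraction and covers the case of equal
  labels.\<close>

lemma label_count_exchange: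
  assumes "finite S" "i \<in> S" "j \<notin> S"
  shows "label_count ls (insert j (S - {i})) e + of_bool (ls ! i = e) = label_count ls S e + of_bool (ls ! j = e)"
  using label_count_insert[of "S - {i}" i ls e] label_count_insert[of "S - {i}" j ls e] assms
  by (auto simp: insert_absorb)

lemma Sig_map_nth: "distinct \<beta> \<Longrightarrow> Sig (map ((!) ls) \<beta>) = label_count ls (set \<beta>)"
proof (rule ext, induction \<beta>)
  case (Cons p \<beta>)
  then show ?case by (simp add: label_count_insert Sig_def)
qed (simp add: Sig_def label_count_def)

lemma Sig_map_nth_le:
  assumes "distinct \<beta>" "set \<beta> \<subseteq> {..<length ls}"
  shows "Sig (map ((!) ls) \<beta>) \<le> Sig ls"
proof -
  have "Sig ls = label_count ls {..<length ls}"
    using Sig_map_nth[of "[0..<length ls]" ls] by (simp add: map_nth lessThan_atLeast0)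
  with assms show ?thesis
    by (auto simp: Sig_map_nth le_fun_def label_count_def intro!: card_mono)
qed

text \<open>The matroid whose elements are the positions of \<open>ls\<close>, regarded as distinct copies of their labels.\<close>

definition polar_bases :: "nat \<Rightarrow> nat list \<Rightarrow> (nat \<Rightarrow> nat) set \<Rightarrow> nat set set" where
  "polar_bases q ls K = {S. S \<subseteq> {..<length ls} \<and> card S = q \<and> label_count ls S \<in> K}"

text \<open>The value zero is imposed on repeated positions, because \<open>\<rho>\<close> need not
  vanish on repeated labels. Distinct positions with equal labels keep the value of
  \<open>\<rho>\<close>.\<close>

definition polar_fun :: "('a, 'b) tract_scheme \<Rightarrow> nat list \<Rightarrow> (nat list \<Rightarrow> 'a) \<Rightarrow> nat list \<Rightarrow> 'a" where
  "polar_fun F ls \<rho> \<beta> = (if distinct \<beta> then \<rho> (map ((!) ls) \<beta>) else tzero F)"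

text \<open>If \<open>A\<close> has more copies of the label of \<open>i\<close> than
  \<open>B\<close>, the exchange property of \<open>J\<close> supplies another label, of which
  \<open>B\<close> has more copies. Otherwise \<open>B\<close> has a copy of the same label outside
  \<open>A\<close>, and swapping the copies changes no counts.\<close>

lemma polar_bases_exchange:
  assumes J: "m_convex n r J" and A: "A \<in> polar_bases q ls (Jbar J)" and B: "B \<in> polar_bases q ls (Jbar J)"
    and i: "i \<in> A - B"
  shows "\<exists>j\<in>B - A. insert j (A - {i}) \<in> polar_bases q ls (Jbar J) \<and> insert i (B - {j}) \<in> polar_bases q ls (Jbar J)"
proof -
  let ?c = "label_count ls"
  have fin: "finite A" "finite B" using A B by (auto simp: polar_bases_def intro: finite_subset)
  obtain j where j: "j \<in> B - A" "?c (insert j (A - {i})) \<in> Jbar J" "?c (insert i (B - {j})) \<in> Jbar J"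
  proof (cases "?c B (ls ! i) < ?c A (ls ! i)")
    case True
    let ?e = "ls ! i"
    obtain f where f: "?c A f < ?c B f" "(?c A)(?e := ?c A ?e - 1, f := ?c A f + 1) \<in> Jbar J"
      "(?c B)(?e := ?c B ?e + 1, f := ?c B f - 1) \<in> Jbar J"
      using Jbar_exchange[OF J, of "?c A" "?c B" ?e] True A B by (auto simp: polar_bases_def)
    have "\<not> {p \<in> B. ls ! p = f} \<subseteq> {p \<in> A. ls ! p = f}"
      using f(1) card_mono[of "{p \<in> A. ls ! p = f}" "{p \<in> B. ls ! p = f}"] fin by (auto simp: label_count_def)
    then obtain j where j: "j \<in> B - A" "ls ! j = f" by auto
    have "f \<noteq> ?e" using True f(1) by auto
    have "?c (insert j (A - {i})) = (?c A)(?e := ?c A ?e - 1, f := ?c A f + 1)"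
    proof
      fix e show "?c (insert j (A - {i})) e = ((?c A)(?e := ?c A ?e - 1, f := ?c A f + 1)) e"
        using label_count_exchange[of A i j ls e] fin i j \<open>f \<noteq> ?e\<close> by (auto simp: of_bool_def split: if_splits)
    qed
    moreover have "?c (insert i (B - {j})) = (?c B)(?e := ?c B ?e + 1, f := ?c B f - 1)"
    proof
      fix e show "?c (insert i (B - {j})) e = ((?c B)(?e := ?c B ?e + 1, f := ?c B f - 1)) e"
        using label_count_exchange[of B j i ls e] fin i j \<open>f \<noteq> ?e\<close> by (auto simp: of_bool_def split: if_splits)
    qed
    ultimately show ?thesis using that[of j] j f(2,3) by simp
  next
    case False
    have "\<not> {p \<in> B. ls ! p = ls ! i} \<subseteq> {p \<in> A. ls ! p = ls ! i}"
    proof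
      assume "{p \<in> B. ls ! p = ls ! i} \<subseteq> {p \<in> A. ls ! p = ls ! i}"
      then have "{p \<in> B. ls ! p = ls ! i} \<subset> {p \<in> A. ls ! p = ls ! i}" using i by auto
      then have "?c B (ls ! i) < ?c A (ls ! i)" using fin by (auto simp: label_count_def intro: psubset_card_mono)
      with False show False ..
    qed
    then obtain j where j: "j \<in> B - A" "ls ! j = ls ! i" by auto
    have "?c (insert j (A - {i})) = ?c A" "?c (insert i (B - {j})) = ?c B"
      using label_count_exchange[of A i j ls] label_count_exchange[of B j i ls] fin i j by (auto simp: fun_eq_iff)
    then show ?thesis using that[of j] j A B by (simp add: polar_bases_def)
  qed
  have "card (insert j (A - {i})) = card A" "card (insert i (B - {j})) = card B"
    using fin i j(1) card_Suc_Diff1[of A i] card_Suc_Diff1[of B j] by auto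
  then show ?thesis using j A B i by (intro bexI[of _ j]) (auto simp: polar_bases_def)
qed

text \<open>On distinct positions each label occurs at most as often as in \<open>ls\<close>, so the
  bound by \<open>omega J\<close> holds and the three-term relations of \<open>\<rho>\<close>
  apply.\<close>

lemma weak_matroid_rep_polar:
  assumes F: "is_tract F" and J: "m_convex n r J" and weak: "weak_rep F n r J \<rho>"
    and ls: "set ls \<subseteq> {..<n}" "Sig ls \<le> omega J"
  shows "weak_matroid_rep F (length ls) (rbar n r J) (polar_fun F ls \<rho>) (polar_bases (rbar n r J) ls (Jbar J))"
proof -
  let ?q = "rbar n r J" and ?m = "length ls" and ?\<phi> = "polar_fun F ls \<rho>"
  interpret tract_laws F by standard (fact F)
  have lab: "map ((!) ls) \<beta> \<in> idx n k" if "\<beta> \<in> idx ?m k" for \<beta> k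
  proof -
    have "ls ! p < n" if "p < length ls" for p using ls(1) nth_mem[OF that] by auto
    with that show ?thesis by (auto simp: idx_def)
  qed
  have nonzero: "\<rho> \<beta> \<noteq> \<zero> \<longleftrightarrow> Sig \<beta> \<in> Jbar J" if "\<beta> \<in> idx n ?q" for \<beta>
    using weak that by (auto simp: weak_rep_def)
  interpret alternating_fun F ?m ?q ?\<phi>
  proof
    fix \<beta> assume "\<beta> \<in> idx ?m ?q"
    then show "?\<phi> \<beta> \<in> tcar F" using weak lab by (simp add: polar_fun_def weak_rep_def)
  next
    show "alternating F ?m ?q ?\<phi>"
      unfolding alternating_def
    proof (intro ballI allI impI)
      fix \<beta> i j assume \<beta>: "\<beta> \<in> idx ?m ?q" and ij: "i < ?q \<and> j < ?q \<and> i \<noteq> j"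
      then have len: "i < length \<beta>" "j < length \<beta>" by (auto simp: idx_def)
      have "\<rho> ((map ((!) ls) \<beta>)[i := map ((!) ls) \<beta> ! j, j := map ((!) ls) \<beta> ! i]) = neg F (\<rho> (map ((!) ls) \<beta>))"
        using weak lab[OF \<beta>] ij unfolding weak_rep_def alternating_def by blast
      moreover have "distinct (\<beta>[i := \<beta> ! j, j := \<beta> ! i]) = distinct \<beta>" using len by (rule distinct_swap)
      ultimately show "?\<phi> (\<beta>[i := \<beta> ! j, j := \<beta> ! i]) = neg F (?\<phi> \<beta>)"
        using len by (simp add: polar_fun_def map_update)
    qed
  qed
  show ?thesis
  proof
    fix \<beta> assume \<beta>: "\<beta> \<in> idx ?m ?q"
    show "?\<phi> \<beta> \<noteq> \<zero> \<longleftrightarrow> distinct \<beta> \<and> set \<beta> \<in> polar_bases ?q ls (Jbar J)"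
    proof (cases "distinct \<beta>")
      case True
      then have "?\<phi> \<beta> \<noteq> \<zero> \<longleftrightarrow> label_count ls (set \<beta>) \<in> Jbar J"
        using nonzero[OF lab[OF \<beta>]] by (simp add: polar_fun_def Sig_map_nth)
      with True \<beta> show ?thesis by (auto simp: polar_bases_def idx_def distinct_card)
    qed (simp add: polar_fun_def)
  next
    fix B assume "B \<in> polar_bases ?q ls (Jbar J)"
    then show "B \<subseteq> {..<?m} \<and> card B = ?q" by (simp add: polar_bases_def)
  next
    fix A B i assume "A \<in> polar_bases ?q ls (Jbar J)" "B \<in> polar_bases ?q ls (Jbar J)" "i \<in> A - B"
    then show "\<exists>j\<in>B - A. insert j (A - {i}) \<in> polar_bases ?q ls (Jbar J) \<and> insert i (B - {j}) \<in> polar_bases ?q ls (Jbar J)"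
      by (rule polar_bases_exchange[OF J])
  next
    fix \<alpha> xs ys assume shape: "gp_shape \<alpha> xs ys 1" and dist: "distinct (\<alpha> @ xs @ ys)"
    then obtain i j k l where xs: "xs = [i, j, k]" and ys: "ys = [l]"
      by (auto simp: gp_shape_def length_Suc_conv numeral_3_eq_3)
    let ?a = "map ((!) ls) \<alpha>"
    have q: "2 \<le> ?q" "?a \<in> idx n (?q - 2)"
      using shape ls(1) by (auto simp: gp_shape_def idx_def subset_iff)
    have n: "ls ! i < n" "ls ! j < n" "ls ! k < n" "ls ! l < n"
      using shape ls(1) by (auto simp: gp_shape_def xs ys subset_iff)
    have "Sig (map ((!) ls) (\<alpha> @ [i, j, k, l])) \<le> Sig ls"
      using shape dist by (intro Sig_map_nth_le) (auto simp: gp_shape_def xs ys)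
    with ls(2) have "Sig (?a @ [ls ! i, ls ! j, ls ! k, ls ! l]) \<le> omega J" by simp
    with weak q n have "null_sum [\<rho> (?a @ [ls ! j, ls ! k]) \<odot> \<rho> (?a @ [ls ! i, ls ! l]),
        neg F (\<rho> (?a @ [ls ! i, ls ! k]) \<odot> \<rho> (?a @ [ls ! j, ls ! l])),
        \<rho> (?a @ [ls ! i, ls ! j]) \<odot> \<rho> (?a @ [ls ! k, ls ! l])]"
      unfolding weak_rep_def by blast
    moreover have "\<rho> (?a @ [ls ! i, ls ! j]) \<odot> \<rho> (?a @ [ls ! k, ls ! l]) \<in> carr"
      using weak q n by (auto simp: weak_rep_def idx_def)
    ultimately show "gp_null \<alpha> xs ys"
      using dist by (simp add: gp_null_def gp_term_def polar_fun_def xs ys upt_rec)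
  qed
qed

text \<open>The list \<open>ls\<close> is the index list of the very relation to be proved. Its
  three blocks of positions form a relation with distinct entries in the polarized matroid, and
  relabelling returns the original one.\<close>

lemma excellentI:
  assumes F: "is_tract F"
    and strong: "\<And>m q \<phi> \<B> d. weak_matroid_rep F m q \<phi> \<B> \<Longrightarrow> weak_matroid_rep.gp_all F m q \<phi> d"
  shows "excellent F"
  unfolding excellent_def strong_rep_def
proof (intro allI impI conjI ballI; elim conjE)
  fix n r J \<rho> s \<alpha> xs ys
  assume J: "m_convex n r J" and weak: "weak_rep F n r J \<rho>" and s: "2 \<le> s" "s \<le> rbar n r J"
    and idx: "\<alpha> \<in> idx n (rbar n r J - s)" "xs \<in> idx n (s + 1)" "ys \<in> idx n (s - 1)"
    and omega: "Sig (\<alpha> @ xs @ ys) \<le> omega J"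
  define ls where "ls = \<alpha> @ xs @ ys"
  define a where "a = length \<alpha>"
  define b where "b = length \<alpha> + length xs"
  let ?q = "rbar n r J" and ?m = "length ls" and ?\<phi> = "polar_fun F ls \<rho>"
  have ls: "set ls \<subseteq> {..<n}" "Sig ls \<le> omega J" using idx omega by (auto simp: ls_def idx_def)
  interpret weak_matroid_rep F ?m ?q ?\<phi> "polar_bases ?q ls (Jbar J)"
    by (rule weak_matroid_rep_polar[OF F J weak ls])
  have lens: "length \<alpha> + s = ?q" "length xs = s + 1" "length ys = s - 1" "length ls = b + length ys" "a \<le> b"
    using s idx by (auto simp: idx_def ls_def a_def b_def)
  have "gp_shape [0..<a] [a..<b] [b..<?m] (s - 1)"
    unfolding gp_shape_def using s lens by (auto simp: a_def b_def)
  then have "gp_null [0..<a] [a..<b] [b..<?m]"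
    using strong[OF weak_matroid_rep_axioms, of "s - 1"] by (simp add: gp_all_def)
  moreover have "gp_term [0..<a] [a..<b] [b..<?m] k = sgnp F k (\<rho> (\<alpha> @ rem k xs) \<odot> \<rho> (\<alpha> @ xs ! k # ys))"
    if k: "k < s + 1" for k
  proof -
    have "map ((!) ls) [0..<a] = \<alpha>" "map ((!) ls) [a..<b] = xs" "map ((!) ls) [b..<?m] = ys"
      unfolding ls_def a_def b_def by (rule nth_equalityI; simp add: nth_append del: upt_Suc)+
    moreover have "[a..<b] ! k = a + k" "ls ! (a + k) = xs ! k" using k lens by (auto simp: a_def b_def ls_def nth_append)
    moreover have "distinct ([0..<a] @ rem k [a..<b])" "distinct ([0..<a] @ (a + k) # [b..<?m])"
      using k lens set_rem_subset[of k "[a..<b]"] by (auto simp: a_def b_def distinct_rem)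
    ultimately show ?thesis by (simp add: gp_term_def polar_fun_def map_rem)
  qed
  then have "map (gp_term [0..<a] [a..<b] [b..<?m]) [0..<s + 1] =
      map (\<lambda>k. sgnp F k (\<rho> (\<alpha> @ rem k xs) \<odot> \<rho> (\<alpha> @ xs ! k # ys))) [0..<s + 1]"
    by (intro map_cong) auto
  moreover have "length [a..<b] = s + 1" using lens by (simp add: a_def b_def)
  ultimately show "null_sum (map (\<lambda>k. sgnp F k (\<rho> (\<alpha> @ rem k xs) \<odot> \<rho> (\<alpha> @ xs ! k # ys))) [0..<s + 1])"
    unfolding gp_null_def by (simp only:)
qed

theorem theoremJ:
  fixes F G :: "'a tract"
  shows "(is_tract F \<and> perfect F \<and> \<not> near_idempotent F \<longrightarrow> excellent F) \<and>
         (is_tract G \<and> degenerate G \<longrightarrow> excellent G) \<and>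
         excellent krasner \<and> excellent tropical"
proof -
  have perf: "excellent F" if "is_tract F" "perfect F" for F :: "'a tract"
    using that weak_matroid_rep.perfect_gp_all by (blast intro: excellentI)
  have deg: "excellent G" if "is_tract G" "degenerate G" for G :: "'a tract"
    using that weak_matroid_rep.degenerate_gp_all by (blast intro: excellentI)
  have "excellent krasner"
    using excellentI[OF is_tract_krasner] weak_matroid_rep.degenerate_gp_all degenerate_krasner by blast
  moreover have "excellent tropical"
    using excellentI[OF is_tract_tropical] tropical_gp_all by blast
  ultimately show ?thesis using perf deg by blast
qed

end
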